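(* Let $\{(\boldsymbol X(t),V(t)),t\ge 0\}$ be the cyclic random motion in $\mathbb R^3$ with the regular-tetrahedron directions described in the context, speed $c>0$, started from the origin with initial direction $\vec v_1$, with intertimes along $\vec v_j$ given by independent geometric counting processes with intensities $\lambda_j>0$, $1\le j\le4$. For $t>0$ let $$\mathcal T(t)=\Big\{(x_1,x_2,x_3)\in\mathbb R^3:\ -\tfrac{ct}3<x_1<ct,\ -\tfrac{ct-x_1}{2\sqrt2}<x_2<\tfrac{ct-x_1}{\sqrt2},\ |x_3|<\tfrac{\sqrt6}6(ct-x_1-\sqrt2x_2)\Big\}.$$ For all $\boldsymbol x\in\mathrm{Int}(\mathcal T(t))$, the densities $p_{1j}(\boldsymbol x,t)\,d\boldsymbol x=\mathbb P_1\{\boldsymbol X(t)\in d\boldsymbol x,V(t)=\vec v_j\}$ are, writing $S=1+A(\boldsymbol\tau)+B(\boldsymbol\tau)+C(\boldsymbol\tau)$ and $D=D(\boldsymbol\tau)$, $$\begin{aligned} p_{11}(\boldsymbol x,t)&=\lambda_1\lambda_2\lambda_3\lambda_4\tau_1\,\frac{S^2+6D\,(S+D)}{\det\boldsymbol A\;S^4},\\ p_{12}(\boldsymbol x,t)&=2\lambda_1^2\lambda_2\lambda_3\lambda_4\tau_1\tau_2(1+\lambda_2\tau_2)(1+\lambda_3\tau_3)(1+\lambda_4\tau_4)\,\frac{S+3D}{\det\boldsymbol A\;S^4},\\ p_{13}(\boldsymbol x,t)&=2\lambda_1^2\lambda_2^2\lambda_3\lambda_4\tau_1\tau_2\tau_3(1+\lambda_3\tau_3)(1+\lambda_4\tau_4)\,\frac{S+3D}{\det\boldsymbol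 A\;S^4},\\ p_{14}(\boldsymbol x,t)&=\lambda_1\lambda_2\lambda_3(1+\lambda_4\tau_4)\,\frac{S^2+6D\,(S+D)}{\det\boldsymbol A\;S^4}, \end{aligned}$$ where $\det\boldsymbol A=\frac{16\sqrt3}9c^3$, $$A(\boldsymbol\tau)=\sum_{i=1}^4\lambda_i\tau_i,\quad B(\boldsymbol\tau)=\sum_{1\le i<j\le4}\lambda_i\lambda_j\tau_i\tau_j,\quad C(\boldsymbol\tau)=\sum_{1\le i<j<k\le4}\lambda_i\lambda_j\lambda_k\tau_i\tau_j\tau_k,\quad D(\boldsymbol\tau)=\prod_{i=1}^4\lambda_i\tau_i,$$ and $$\tau_1=\frac{ct+3x_1}{4c},\quad\tau_2=\frac{ct-x_1+2\sqrt2x_2}{4c},\quad\tau_3=\frac{ct-x_1-\sqrt2x_2+\sqrt6x_3}{4c},\quad\tau_4=\frac{ct-x_1-\sqrt2x_2-\sqrt6x_3}{4c}.$$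
   Context: Directions: $\vec v_1=(1,0,0)$, $\vec v_2=(-\tfrac13,\tfrac{2\sqrt2}3,0)$, $\vec v_3=(-\tfrac13,-\tfrac{\sqrt2}3,\sqrt{\tfrac23})$, $\vec v_4=(-\tfrac13,-\tfrac{\sqrt2}3,-\sqrt{\tfrac23})$. $\mathcal T(t)$ in the claim is the regular tetrahedron with vertices $ct\,\vec v_j$. $\boldsymbol A$ is the $4\times 4$ matrix with $j$-th column $(c\vec v_j,1)^T$. Durations. For each $j\in\{1,2,3,4\}$, $(D_{j,k})_{k\ge1}$ is the sequence of interarrival times of a geometric counting process (GCP) with intensity $\lambda_j>0$: a mixed Poisson process whose random intensity $\alpha_j$ is exponentially distributed with mean $\lambda_j$ (given $\alpha_j$, the $D_{j,k}$, $k\ge 1$, are i.i.d. exponential with rate $\alpha_j$). The four sequences are mutually independent. Put $D_j^{(0)}=0$, $D_j^{(k)}=\sum_{i=1}^kD_{j,i}$. Motion. The particle starts at the origin at time $0$ with direction $\vec v_1$ and takes directions cyclically $\vec v_1\to\vec v_2\to\vec v_3\to\vec v_4\to\vec v_1\to\cdots$; during the $k$-th cycle it moves along $\vec v_j$ for a time $D_{j,k}$. Thus the switching times are $T_0=0$ and $T_{4n+j}=\sum_{r=1}^{j}D_r^{(n+1)}+\sum_{r=j+1}^{4}D_r^{(n)}$ for $n\ge0$, $1\le j\le4$; $V(t)=\vec v_j$ for $T_{4n+j-1}\le t<T_{4n+j}$; and $\boldsymbol X(t)=c\int_0^tV(s)\,ds$. $\mathbb P_1$ denotes probability conditional on $\{\boldsymbol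 X(0)=\boldsymbol 0, V(0)=\vec v_1\}$. Density: $p_{1j}(\cdot,t)$ satisfies $\mathbb P_1\{\boldsymbol X(t)\in B,V(t)=\vec v_j\}=\int_Bp_{1j}(\boldsymbol x,t)\,d\boldsymbol x$ for every Borel $B\subseteq\mathrm{Int}(\mathcal T(t))$; the equalities are equalities of densities.
   Formalization: In the formula for p_13 the factor S+3D is replaced by 2S+3D, since the printed factor is false for all parameters: the sum over cycles of n(n+1)^2 z^n with z=D/(S+D) equals 2z(2+z)/(1-z)^4, and 2+z=(2S+3D)/(S+D). *)

theory Defs
  imports "HOL-Probability.Probability"
begin

definition dir :: "nat \<Rightarrow> real ^ 3" where
  "dir j =
    (if j = 1 then vector [1, 0, 0]
     else if j = 2 then vector [- 1 / 3, 2 * sqrt 2 / 3, 0]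
     else if j = 3 then vector [- 1 / 3, - sqrt 2 / 3, sqrt (2 / 3)]
     else vector [- 1 / 3, - sqrt 2 / 3, - sqrt (2 / 3)])"

(* The j-th column is (c * dir j, 1). *)
definition dir_matrix :: "real \<Rightarrow> real ^ 4 ^ 4" where
  "dir_matrix c = transpose (vector
     (map (\<lambda>j. vector [c * dir j $ 1, c * dir j $ 2, c * dir j $ 3, 1]) [1, 2, 3, 4]))"

definition tetrahedron :: "real \<Rightarrow> real \<Rightarrow> (real ^ 3) set" where
  "tetrahedron c t = {x.
      - (c * t / 3) < x $ 1 \<and> x $ 1 < c * t \<and>
      - ((c * t - x $ 1) / (2 * sqrt 2)) < x $ 2 \<and> x $ 2 < (c * t - x $ 1) / sqrt 2 \<and>
      \<bar>x $ 3\<bar> < sqrt 6 / 6 * (c * t - x $ 1 - sqrt 2 * x $ 2)}"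

(* E 1, E 2, ... are the interarrival times of a mixed Poisson process with random intensity a,
   where a is exponential with mean l (exponential_density takes the rate, hence 1 / l):
   conditionally on a, they are i.i.d. exponential with rate a. The value E 0 is not used. *)
definition gcp_interarrivals ::
    "'w measure \<Rightarrow> real \<Rightarrow> ('w \<Rightarrow> real) \<Rightarrow> (nat \<Rightarrow> 'w \<Rightarrow> real) \<Rightarrow> bool" where
  "gcp_interarrivals M l a E \<longleftrightarrow>
     distributed M lborel a (\<lambda>x. ennreal (exponential_density (1 / l) x)) \<and>
     (\<forall>k\<ge>1. E k \<in> borel_measurable M) \<and>
     (\<forall>n B. (\<forall>k\<in>{1..n}. B k \<in> sets borel) \<longrightarrow>
        (AE \<omega> in M.
           real_cond_exp M (vimage_algebra (space M) a borel)
             (indicator {\<omega>' \<in> space M. \<forall>k\<in>{1..n}. E k \<omega>' \<in> B k}) \<omega>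
           = (\<Prod>k\<in>{1..n}.
                measure (density lborel (\<lambda>x. ennreal (exponential_density (a \<omega>) x))) (B k))))"

definition total_time :: "(nat \<Rightarrow> nat \<Rightarrow> 'w \<Rightarrow> real) \<Rightarrow> nat \<Rightarrow> nat \<Rightarrow> 'w \<Rightarrow> real" where
  "total_time D j k \<omega> = (\<Sum>i = 1..k. D j i \<omega>)"

(* The time of the m-th switch, m = 4 * n + j. Taking j = m mod 4 in {0..3} covers j = 4 as well:
   the formula for (n, 4) is the same as the one for (n + 1, 0). For m = 0 it gives 0. *)
definition switch_time :: "(nat \<Rightarrow> nat \<Rightarrow> 'w \<Rightarrow> real) \<Rightarrow> nat \<Rightarrow> 'w \<Rightarrow> real" where
  "switch_time D m \<omega> =
     (\<Sum>r = 1..m mod 4. total_time D r (m div 4 + 1) \<omega>)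
     + (\<Sum>r = m mod 4 + 1..4. total_time D r (m div 4) \<omega>)"

(* Almost surely the switching times increase strictly from 0 to infinity, and then for t >= 0 this
   is the unique m with switch_time D m <= t < switch_time D (m + 1). Elsewhere (a null event) the
   value is immaterial. *)
definition num_switches :: "(nat \<Rightarrow> nat \<Rightarrow> 'w \<Rightarrow> real) \<Rightarrow> real \<Rightarrow> 'w \<Rightarrow> nat" where
  "num_switches D t \<omega> = (LEAST m. t < switch_time D (m + 1) \<omega>)"

definition velocity :: "(nat \<Rightarrow> nat \<Rightarrow> 'w \<Rightarrow> real) \<Rightarrow> real \<Rightarrow> 'w \<Rightarrow> real ^ 3" where
  "velocity D t \<omega> = dir (num_switches D t \<omega> mod 4 + 1)"

definition position :: "real \<Rightarrow> (nat \<Rightarrow> nat \<Rightarrow> 'w \<Rightarrow> real) \<Rightarrow> real \<Rightarrow> 'w \<Rightarrow> real ^ 3" where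
  "position c D t \<omega> = c *\<^sub>R (LINT s:{0..t}|lborel. velocity D s \<omega>)"

(* p is a density, on the subsets of the interior of the tetrahedron, of the position at time t on
   the event that the current direction is dir j, given the initial position and direction. *)
definition is_motion_density ::
    "'w measure \<Rightarrow> real \<Rightarrow> (nat \<Rightarrow> nat \<Rightarrow> 'w \<Rightarrow> real) \<Rightarrow> real \<Rightarrow> nat \<Rightarrow> (real ^ 3 \<Rightarrow> real) \<Rightarrow> bool" where
  "is_motion_density M c D t j p \<longleftrightarrow>
     (\<forall>B \<in> sets borel. B \<subseteq> interior (tetrahedron c t) \<longrightarrow>
        set_integrable lborel B p \<and>
        \<P>(\<omega> in M. position c D t \<omega> \<in> B \<and> velocity D t \<omega> = dir j
              \<bar> position c D 0 \<omega> = 0 \<and> velocity D 0 \<omega> = dir 1)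
        = (LINT x:B|lborel. p x))"

(* The time spent in direction dir j up to time t when the position at time t is x. *)
definition tau :: "real \<Rightarrow> real \<Rightarrow> real ^ 3 \<Rightarrow> nat \<Rightarrow> real" where
  "tau c t x j =
    (if j = 1 then (c * t + 3 * x $ 1) / (4 * c)
     else if j = 2 then (c * t - x $ 1 + 2 * sqrt 2 * x $ 2) / (4 * c)
     else if j = 3 then (c * t - x $ 1 - sqrt 2 * x $ 2 + sqrt 6 * x $ 3) / (4 * c)
     else (c * t - x $ 1 - sqrt 2 * x $ 2 - sqrt 6 * x $ 3) / (4 * c))"

definition fA :: "(nat \<Rightarrow> real) \<Rightarrow> (nat \<Rightarrow> real) \<Rightarrow> real" where
  "fA l s = (\<Sum>i = 1..4. l i * s i)"

definition fB :: "(nat \<Rightarrow> real) \<Rightarrow> (nat \<Rightarrow> real) \<Rightarrow> real" where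
  "fB l s = (\<Sum>j = 1..4. \<Sum>i = 1..<j. l i * l j * s i * s j)"

definition fC :: "(nat \<Rightarrow> real) \<Rightarrow> (nat \<Rightarrow> real) \<Rightarrow> real" where
  "fC l s = (\<Sum>k = 1..4. \<Sum>j = 1..<k. \<Sum>i = 1..<j. l i * l j * l k * s i * s j * s k)"

definition fD :: "(nat \<Rightarrow> real) \<Rightarrow> (nat \<Rightarrow> real) \<Rightarrow> real" where
  "fD l s = (\<Prod>i = 1..4. l i * s i)"

definition fS :: "(nat \<Rightarrow> real) \<Rightarrow> (nat \<Rightarrow> real) \<Rightarrow> real" where
  "fS l s = 1 + fA l s + fB l s + fC l s"

end

theory Submission
  imports Defs
begin

text \<open>
  The motion is encoded by the total times spent in the four directions. If exactly \<open>m = 4 * q + (j - 1)\<close>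
  switches have happened by time \<open>t\<close>, then the directions before \<open>j\<close> have completed \<open>q + 1\<close> sojourns, the
  directions after \<open>j\<close> have completed \<open>q\<close>, and direction \<open>j\<close> uses up the time that is left. The position is the
  corresponding combination of the direction vectors (\<open>positive_path.position_eq\<close>), and since the vectors are the
  vertices of a simplex, it determines the four times, which are the coordinates \<open>tau\<close>
  (\<open>tau_point\<close>).

  So the density at \<open>x\<close>, on the event of \<open>m\<close> switches, is the joint density of the three finished total times
  at \<open>tau c t x\<close>, times the probability that the counting process of direction \<open>j\<close> has had exactly \<open>q\<close>
  events at the time \<open>tau c t x j\<close>, divided by the Jacobian (\<open>cyclic_motion.state_probability\<close>). The
  Jacobian of the affine map from three of the times to the position is \<open>det (dir_matrix c)\<close>, whichever three are
  chosen (\<open>nn_integral_PiM_exchange\<close>, \<open>point_integral_substitution\<close>).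

  Independence of the directions makes the joint density a product. For a geometric counting process,
  integrating the Erlang density of the \<open>k\<close>-th event time over the exponentially distributed rate gives
  \<open>k * l ^ k * y ^ (k - 1) / (1 + l * y) ^ (k + 1)\<close> (\<open>prob_space.gcp_waiting_time_distributed\<close>), with
  distribution function \<open>(l * y / (1 + l * y)) ^ k\<close>; a difference of two of these is the probability of
  \<open>q\<close> events (\<open>prob_space.gcp_count_probability\<close>).

  In the product the ratios \<open>l * y / (1 + l * y)\<close> of the four directions combine to \<open>z ^ q\<close> with
  \<open>z = Q / (S + Q)\<close>, because \<open>S + Q\<close> is the product of the factors \<open>1 + l * y\<close>. The three waiting time
  densities contribute the factors \<open>q\<close> or \<open>q + 1\<close>. Hence the sum over the cycles \<open>q\<close> is a power series in \<open>z\<close> with a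
  cubic polynomial as coefficient, and its closed form has the denominator \<open>(1 - z) ^ 4\<close>, the source of
  \<open>S ^ 4\<close> (\<open>cubic_sums\<close>, \<open>state_density_series\<close>).
\<close>

section \<open>Power series with cubic coefficients\<close>

text \<open>
  Repeated termwise differentiation of the geometric series. The products of consecutive integers
  serve as a basis in which every cubic polynomial in the index can be summed.
\<close>

lemma rising_products_sums:
  fixes z :: real
  assumes z: "\<bar>z\<bar> < 1"
  shows "(\<lambda>n. (real n + 1) * z ^ n) sums (1 / (1 - z) ^ 2)"
    and "(\<lambda>n. (real n + 1) * (real n + 2) * z ^ n) sums (2 / (1 - z) ^ 3)"
    and "(\<lambda>n. (real n + 1) * (real n + 2) * (real n + 3) * z ^ n) sums (6 / (1 - z) ^ 4)"
proof -
  have s1: "(\<lambda>n. (real n + 1) * z ^ n) sums (1 / (1 - z) ^ 2)" if "norm z < 1" for z :: real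
    using geometric_deriv_sums[OF that] by (simp add: add.commute)
  have s2: "(\<lambda>n. (real n + 1) * (real n + 2) * z ^ n) sums (2 / (1 - z) ^ 3)"
    if "norm z < 1" for z :: real
  proof -
    have "((\<lambda>z. 1 / (1 - z) ^ 2) has_field_derivative 2 / (1 - z) ^ 3) (at z)"
      using that by (auto intro!: derivative_eq_intros) (simp add: divide_simps eval_nat_numeral)
    from termdiffs_sums_strong[OF s1 this that] show ?thesis
      by (simp add: diffs_def algebra_simps)
  qed
  have s3: "(\<lambda>n. (real n + 1) * (real n + 2) * (real n + 3) * z ^ n) sums (6 / (1 - z) ^ 4)"
    if "norm z < 1" for z :: real
  proof -
    have "((\<lambda>z. 2 / (1 - z) ^ 3) has_field_derivative 6 / (1 - z) ^ 4) (at z)"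
      using that by (auto intro!: derivative_eq_intros) (simp add: divide_simps eval_nat_numeral)
    from termdiffs_sums_strong[OF s2 this that] show ?thesis
      by (simp add: diffs_def algebra_simps)
  qed
  show "(\<lambda>n. (real n + 1) * z ^ n) sums (1 / (1 - z) ^ 2)"
    and "(\<lambda>n. (real n + 1) * (real n + 2) * z ^ n) sums (2 / (1 - z) ^ 3)"
    and "(\<lambda>n. (real n + 1) * (real n + 2) * (real n + 3) * z ^ n) sums (6 / (1 - z) ^ 4)"
    using s1[of z] s2[of z] s3[of z] z by auto
qed

text \<open>
  The four polynomials are \<open>k\<^sub>1 * k\<^sub>2 * k\<^sub>3\<close> with each factor \<open>n\<close> or \<open>n + 1\<close>: during the \<open>n\<close>-th cycle
  each of the three directions other than the current one contributes the factor that counts its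
  finished sojourns.
\<close>

lemma cubic_sums:
  fixes z :: real
  assumes z: "\<bar>z\<bar> < 1"
  shows "(\<lambda>n. real n ^ 3 * z ^ n) sums (z * (1 + 4 * z + z ^ 2) / (1 - z) ^ 4)"
    and "(\<lambda>n. real n ^ 2 * (real n + 1) * z ^ n) sums (2 * z * (1 + 2 * z) / (1 - z) ^ 4)"
    and "(\<lambda>n. real n * (real n + 1) ^ 2 * z ^ n) sums (2 * z * (2 + z) / (1 - z) ^ 4)"
    and "(\<lambda>n. (real n + 1) ^ 3 * z ^ n) sums ((1 + 4 * z + z ^ 2) / (1 - z) ^ 4)"
proof -
  note S = rising_products_sums[OF z] geometric_sums[of z]
  have eq: "p / (1 - z) ^ 4 =
        w * (6 / (1 - z) ^ 4) + u * (2 / (1 - z) ^ 3) + v * (1 / (1 - z) ^ 2) + q * (1 / (1 - z))"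
    if "p = w * 6 + u * 2 * (1 - z) + v * (1 - z) ^ 2 + q * (1 - z) ^ 3" for p u v w q
    using z that by (simp add: divide_simps) (simp add: eval_nat_numeral algebra_simps)
  \<comment> \<open>w, u, v, q: coordinates of f in the basis of products of consecutive integers\<close>
  have gen: "(\<lambda>n. f n * z ^ n) sums (p / (1 - z) ^ 4)"
    if "\<And>n. f n = w * ((real n + 1) * (real n + 2) * (real n + 3)) + u * ((real n + 1) * (real n + 2)) + v * (real n + 1) + q"
      "p = w * 6 + u * 2 * (1 - z) + v * (1 - z) ^ 2 + q * (1 - z) ^ 3" for f :: "nat \<Rightarrow> real" and p u v w q
  proof -
    have *: "f n * z ^ n = w * ((real n + 1) * (real n + 2) * (real n + 3) * z ^ n)
      + u * ((real n + 1) * (real n + 2) * z ^ n) + v * ((real n + 1) * z ^ n) + q * z ^ n" for n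
      unfolding that(1) by (simp add: algebra_simps)
    show ?thesis
      unfolding * eq[OF that(2)]
      by (intro sums_add sums_mult) (use S z in auto)
  qed
  show "(\<lambda>n. real n ^ 3 * z ^ n) sums (z * (1 + 4 * z + z ^ 2) / (1 - z) ^ 4)"
    by (rule gen[where w = 1 and u = "-6" and v = 7 and q = "-1"]) (simp_all add: eval_nat_numeral algebra_simps)
  show "(\<lambda>n. real n ^ 2 * (real n + 1) * z ^ n) sums (2 * z * (1 + 2 * z) / (1 - z) ^ 4)"
    by (rule gen[where w = 1 and u = "-5" and v = 4 and q = 0]) (simp_all add: eval_nat_numeral algebra_simps)
  show "(\<lambda>n. real n * (real n + 1) ^ 2 * z ^ n) sums (2 * z * (2 + z) / (1 - z) ^ 4)"
    by (rule gen[where w = 1 and u = "-4" and v = 2 and q = 0]) (simp_all add: eval_nat_numeral algebra_simps)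
  show "(\<lambda>n. (real n + 1) ^ 3 * z ^ n) sums ((1 + 4 * z + z ^ 2) / (1 - z) ^ 4)"
    by (rule gen[where w = 1 and u = "-3" and v = 1 and q = 0]) (simp_all add: eval_nat_numeral algebra_simps)
qed

section \<open>Sojourn times as coordinates on the tetrahedron\<close>

text \<open>
  Rewriting every radical through the square roots of 2 and 3 makes identities between the coordinates
  of the directions decidable by field arithmetic.
\<close>

lemma sqrt_collapse:
  "sqrt 6 = sqrt 2 * sqrt 3" "sqrt (2 / 3) = sqrt 2 * sqrt 3 / 3"
  "sqrt 2 * (sqrt 2 * x) = 2 * x" "sqrt 3 * (sqrt 3 * x) = 3 * x"
proof -
  show "sqrt (2 / 3) = sqrt 2 * sqrt 3 / 3"
    by (simp add: real_sqrt_divide field_simps)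
qed (simp_all flip: real_sqrt_mult mult.assoc)

lemma det_4:
  fixes A :: "'a::comm_ring_1 ^ 4 ^ 4"
  shows "det A =
    A$1$1 * (A$2$2 * (A$3$3 * A$4$4 - A$3$4 * A$4$3) - A$2$3 * (A$3$2 * A$4$4 - A$3$4 * A$4$2)
      + A$2$4 * (A$3$2 * A$4$3 - A$3$3 * A$4$2))
  - A$1$2 * (A$2$1 * (A$3$3 * A$4$4 - A$3$4 * A$4$3) - A$2$3 * (A$3$1 * A$4$4 - A$3$4 * A$4$1)
      + A$2$4 * (A$3$1 * A$4$3 - A$3$3 * A$4$1))
  + A$1$3 * (A$2$1 * (A$3$2 * A$4$4 - A$3$4 * A$4$2) - A$2$2 * (A$3$1 * A$4$4 - A$3$4 * A$4$1)
      + A$2$4 * (A$3$1 * A$4$2 - A$3$2 * A$4$1))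
  - A$1$4 * (A$2$1 * (A$3$2 * A$4$3 - A$3$3 * A$4$2) - A$2$2 * (A$3$1 * A$4$3 - A$3$3 * A$4$1)
      + A$2$3 * (A$3$1 * A$4$2 - A$3$2 * A$4$1))"
proof -
  have f1: "finite {2::4, 3, 4}" "1 \<notin> {2::4, 3, 4}"
    and f2: "finite {3::4, 4}" "2 \<notin> {3::4, 4}"
    and f3: "finite {4::4}" "3 \<notin> {4::4}" by auto
  show ?thesis
    unfolding det_def UNIV_4
    unfolding sum_over_permutations_insert[OF f1]
    unfolding sum_over_permutations_insert[OF f2]
    unfolding sum_over_permutations_insert[OF f3]
    unfolding permutes_sing
    by (simp add: sign_swap_id permutation_swap_id permutation_compose sign_compose sign_id swap_id_eq
        algebra_simps)
qed

lemma det_dir_matrix: "det (dir_matrix c) = 16 * sqrt 3 / 9 * c ^ 3"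
proof -
  have v4: "(vector [u, v, w, z] :: ('b::zero) ^ 4) $ 1 = u" "(vector [u, v, w, z] :: ('b::zero) ^ 4) $ 2 = v"
    "(vector [u, v, w, z] :: ('b::zero) ^ 4) $ 3 = w" "(vector [u, v, w, z] :: ('b::zero) ^ 4) $ 4 = z" for u v w z :: "'b::zero"
    by (simp_all add: vector_def)
  show ?thesis
    unfolding det_4
    by (simp add: dir_matrix_def transpose_def v4 dir_def sqrt_collapse field_simps power3_eq_cube)
qed

definition point :: "real \<Rightarrow> (nat \<Rightarrow> real) \<Rightarrow> real ^ 3" where
  "point c y = c *\<^sub>R (\<Sum>r = 1..4. y r *\<^sub>R dir r)"

lemma nat_upto_4: "{1..4} = {1, 2, 3, 4::nat}" by auto

lemma point_nth:
  "point c y $ 1 = c * (y 1 - (y 2 + y 3 + y 4) / 3)"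
  "point c y $ 2 = c * sqrt 2 / 3 * (2 * y 2 - y 3 - y 4)"
  "point c y $ 3 = c * sqrt 2 * sqrt 3 / 3 * (y 3 - y 4)"
  unfolding point_def nat_upto_4 by (simp_all add: dir_def sqrt_collapse field_simps)

text \<open>
  Together with the total time, the barycentric coordinates \<open>tau\<close> invert \<open>point\<close>; hence the position at
  time \<open>t\<close> determines all four sojourn times.
\<close>

lemma tau_point:
  assumes "c > 0" "r \<in> {1..4}" "(\<Sum>i = 1..4. y i) = t"
  shows "tau c t (point c y) r = y r"
proof -
  have t: "t = y 1 + y 2 + y 3 + y 4" using assms(3) unfolding nat_upto_4 by simp
  show ?thesis
    using assms(1,2) unfolding t tau_def point_nth nat_upto_4
    by (auto simp: sqrt_collapse field_simps)
qed

lemma tau_pos: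
  assumes "c > 0" "x \<in> tetrahedron c t" "r \<in> {1..4}"
  shows "tau c t x r > 0"
proof -
  have 6: "sqrt 6 / 6 * w * sqrt 6 = w" for w by (simp add: field_simps)
  have "\<bar>x $ 3\<bar> * sqrt 6 < sqrt 6 / 6 * (c * t - x $ 1 - sqrt 2 * x $ 2) * sqrt 6"
    using assms(2) by (intro mult_strict_right_mono) (auto simp: tetrahedron_def)
  then have "\<bar>sqrt 6 * x $ 3\<bar> < c * t - x $ 1 - sqrt 2 * x $ 2"
    unfolding 6 by (simp add: abs_mult mult.commute)
  then show ?thesis
    using assms unfolding nat_upto_4 tetrahedron_def
    by (auto simp: tau_def field_simps abs_less_iff)
qed

lemma borel_measurable_tau [measurable]: "(\<lambda>x. tau c t x r) \<in> borel_measurable borel"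
proof -
  have [measurable]: "(\<lambda>x :: real ^ 3. x $ i) \<in> borel_measurable borel" for i
    by (intro borel_measurable_continuous_onI continuous_intros)
  show ?thesis
    unfolding tau_def by (cases "r = 1"; cases "r = 2"; cases "r = 3"; simp)
qed

text \<open>
  Lebesgue measure on vectors is reduced to iterated one-dimensional integrals, so that a change of
  variables needs only affine substitutions on the line.
\<close>

lemma borel_measurable_vector3:
  "(\<lambda>(u, v, w). vector [u, v, w] :: real ^ 3) \<in> borel_measurable (lborel \<Otimes>\<^sub>M lborel \<Otimes>\<^sub>M lborel)"
proof -
  have "vector [u, v, w] = u *\<^sub>R axis 1 1 + v *\<^sub>R axis 2 1 + w *\<^sub>R (axis 3 1 :: real ^ 3)" for u v w :: real
    by (simp add: vec_eq_iff forall_3 axis_def)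
  then show ?thesis by (simp add: split_def)
qed

lemma lborel_real3:
  "(lborel :: (real ^ 3) measure) =
     distr (lborel \<Otimes>\<^sub>M lborel \<Otimes>\<^sub>M lborel) borel (\<lambda>(u, v, w). vector [u, v, w])"
proof -
  have sf: "sigma_finite_measure (lborel \<Otimes>\<^sub>M lborel :: (real \<times> real) measure)"
    by (simp add: lborel_prod sigma_finite_lborel)
  show ?thesis
  proof (rule lborel_eqI)
    fix l u :: "real ^ 3"
    assume le: "\<And>b. b \<in> Basis \<Longrightarrow> l \<bullet> b \<le> u \<bullet> b"
    have le': "l $ i \<le> u $ i" for i
      using le[of "axis i 1"] by (simp add: inner_axis axis_in_Basis_iff)
    have "(\<lambda>(u, v, w). vector [u, v, w]) -` box l u \<inter> space (lborel \<Otimes>\<^sub>M lborel \<Otimes>\<^sub>M lborel)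
        = {l $ 1 <..< u $ 1} \<times> {l $ 2 <..< u $ 2} \<times> {l $ 3 <..< u $ 3}"
      by (auto simp: mem_box_cart forall_3 space_pair_measure)
    then have "emeasure (distr (lborel \<Otimes>\<^sub>M lborel \<Otimes>\<^sub>M lborel) borel (\<lambda>(u, v, w). vector [u, v, w])) (box l u)
        = emeasure (lborel \<Otimes>\<^sub>M lborel \<Otimes>\<^sub>M lborel) ({l $ 1 <..< u $ 1} \<times> {l $ 2 <..< u $ 2} \<times> {l $ 3 <..< u $ 3})"
      by (subst emeasure_distr[OF borel_measurable_vector3]) auto
    also have "\<dots> = ennreal ((u - l) $ 1 * (u - l) $ 2 * (u - l) $ 3)"
      using le' by (simp add: sigma_finite_measure.emeasure_pair_measure_Times[OF sf] lborel.emeasure_pair_measure_Times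
          ennreal_mult mult.assoc del: lborel_prod)
    also have "(u - l) $ 1 * (u - l) $ 2 * (u - l) $ 3 = (\<Prod>b\<in>Basis. (u - l) \<bullet> b)"
    proof -
      have B: "(Basis :: (real ^ 3) set) = (\<lambda>i. axis i 1) ` UNIV" by (auto simp: Basis_vec_def)
      have "inj (\<lambda>i. axis i 1 :: real ^ 3)" by (simp add: inj_on_def axis_eq_axis)
      then have "(\<Prod>b\<in>Basis. (u - l) \<bullet> b) = (\<Prod>i\<in>UNIV. (u - l) \<bullet> axis i 1)"
        unfolding B by (subst prod.reindex) (auto simp: o_def)
      also have "\<dots> = (\<Prod>i\<in>UNIV. (u - l) $ i)" by (simp add: inner_axis)
      also have "\<dots> = (u - l) $ 1 * (u - l) $ 2 * (u - l) $ 3"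
        unfolding UNIV_3 by (simp add: mult.assoc)
      finally show ?thesis by (rule sym)
    qed
    finally show "emeasure (distr (lborel \<Otimes>\<^sub>M lborel \<Otimes>\<^sub>M lborel) borel (\<lambda>(u, v, w). vector [u, v, w])) (box l u)
        = ennreal (\<Prod>b\<in>Basis. (u - l) \<bullet> b)" .
  qed simp
qed


lemma nn_integral_real3:
  assumes [measurable]: "f \<in> borel_measurable borel"
  shows "(\<integral>\<^sup>+x. f x \<partial>(lborel :: (real ^ 3) measure)) =
    (\<integral>\<^sup>+u. \<integral>\<^sup>+v. \<integral>\<^sup>+w. f (vector [u, v, w]) \<partial>lborel \<partial>lborel \<partial>lborel)"
proof -
  have sf: "sigma_finite_measure (lborel \<Otimes>\<^sub>M lborel :: (real \<times> real) measure)"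
    by (simp add: lborel_prod sigma_finite_lborel)
  have [measurable]: "(\<lambda>(u, v, w). vector [u, v, w] :: real ^ 3)
      \<in> borel_measurable (lborel \<Otimes>\<^sub>M lborel \<Otimes>\<^sub>M lborel)"
    by (rule borel_measurable_vector3)
  have "(\<integral>\<^sup>+x. f x \<partial>(lborel :: (real ^ 3) measure)) =
      (\<integral>\<^sup>+p. f (case p of (u, v, w) \<Rightarrow> vector [u, v, w]) \<partial>(lborel \<Otimes>\<^sub>M lborel \<Otimes>\<^sub>M lborel))"
    by (subst lborel_real3) (rule nn_integral_distr; measurable)
  also have "\<dots> = (\<integral>\<^sup>+u. \<integral>\<^sup>+q. f (case (u, q) of (u, v, w) \<Rightarrow> vector [u, v, w])
      \<partial>(lborel \<Otimes>\<^sub>M lborel) \<partial>lborel)"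
    by (rule sigma_finite_measure.nn_integral_fst[OF sf, symmetric]) measurable
  also have "\<dots> = (\<integral>\<^sup>+u. \<integral>\<^sup>+v. \<integral>\<^sup>+w. f (case (u, v, w) of (u, v, w) \<Rightarrow> vector [u, v, w])
      \<partial>lborel \<partial>lborel \<partial>lborel)"
    by (intro nn_integral_cong lborel.nn_integral_fst[symmetric]) measurable
  finally show ?thesis by simp
qed

lemma nn_integral_PiM_123:
  fixes h :: "real \<Rightarrow> real \<Rightarrow> real \<Rightarrow> ennreal"
  assumes [measurable]: "(\<lambda>(u, v, w). h u v w) \<in> borel_measurable (borel \<Otimes>\<^sub>M borel \<Otimes>\<^sub>M borel)"
  shows "(\<integral>\<^sup>+y. h (y 1) (y 2) (y 3) \<partial>PiM {1, 2, 3 :: nat} (\<lambda>_. lborel)) =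
    (\<integral>\<^sup>+u. \<integral>\<^sup>+v. \<integral>\<^sup>+w. h u v w \<partial>lborel \<partial>lborel \<partial>lborel)"
proof -
  interpret product_sigma_finite "\<lambda>_ :: nat. lborel :: real measure" ..
  have [measurable (raw)]: "(\<lambda>x. h (a x) (b x) (d x)) \<in> borel_measurable N"
    if "a \<in> borel_measurable N" "b \<in> borel_measurable N" "d \<in> borel_measurable N" for a b d and N :: "'z measure"
    using measurable_compose[OF measurable_Pair[OF that(1) measurable_Pair[OF that(2,3)]] assms] by simp
  show ?thesis
    by (simp add: product_nn_integral_insert_rev PiM_empty)
qed

text \<open>
  On the hyperplane where the coordinates add up to \<open>t\<close>, any one coordinate may be eliminated. The
  surface measure does not depend on the choice, since trading \<open>y i\<close> for
  \<open>y j = t - y i - \<dots>\<close> is a reflection of the line followed by a translation. This lets the four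
  directions share one change of variables, the one that eliminates the fourth sojourn time.
\<close>

lemma nn_integral_PiM_exchange:
  fixes H :: "('i \<Rightarrow> real) \<Rightarrow> ennreal"
  assumes I: "finite I" "i \<in> I" "j \<in> I"
    and [measurable]: "H \<in> borel_measurable (PiM I (\<lambda>_. borel))"
  shows "(\<integral>\<^sup>+y. H (y(i := t - (\<Sum>r\<in>I - {i}. y r))) \<partial>PiM (I - {i}) (\<lambda>_. lborel)) =
    (\<integral>\<^sup>+y. H (y(j := t - (\<Sum>r\<in>I - {j}. y r))) \<partial>PiM (I - {j}) (\<lambda>_. lborel))"
proof (cases "i = j")
  case False
  interpret product_sigma_finite "\<lambda>_ :: 'i. lborel :: real measure" ..
  define K where "K = I - {i, j}"
  have K: "finite K" "i \<notin> K" "j \<notin> K" "I - {i} = insert j K" "I - {j} = insert i K" "I = insert i (insert j K)"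
    "I = insert j (insert i K)"
    using I False by (auto simp: K_def)
  have [measurable]: "H \<in> borel_measurable (PiM (insert i (insert j K)) (\<lambda>_. borel))"
     "H \<in> borel_measurable (PiM (insert j (insert i K)) (\<lambda>_. borel))"
    using K assms(4) by metis+
  have ne: "r \<noteq> i" "r \<noteq> j" if "r \<in> K" for r using that K by auto
  have "(\<integral>\<^sup>+y. H (y(i := t - (\<Sum>r\<in>I - {i}. y r))) \<partial>PiM (I - {i}) (\<lambda>_. lborel)) =
    (\<integral>\<^sup>+y. \<integral>\<^sup>+u. H (y(j := u, i := t - (u + (\<Sum>r\<in>K. y r)))) \<partial>lborel \<partial>PiM K (\<lambda>_. lborel))"
    unfolding K(4) using K False by (subst product_nn_integral_insert) (auto simp: ne cong: sum.cong)
  also have "\<dots> =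
    (\<integral>\<^sup>+y. \<integral>\<^sup>+u. H (y(i := u, j := t - (u + (\<Sum>r\<in>K. y r)))) \<partial>lborel \<partial>PiM K (\<lambda>_. lborel))"
  proof (rule nn_integral_cong)
    fix y assume y: "y \<in> space (PiM K (\<lambda>_. lborel :: real measure))"
    show "(\<integral>\<^sup>+u. H (y(j := u, i := t - (u + (\<Sum>r\<in>K. y r)))) \<partial>lborel) =
       (\<integral>\<^sup>+u. H (y(i := u, j := t - (u + (\<Sum>r\<in>K. y r)))) \<partial>lborel)"
    proof -
      have [measurable]: "(\<lambda>u. H (y(j := u, i := t - (u + (\<Sum>r\<in>K. y r))))) \<in> borel_measurable borel"
      proof (rule measurable_compose[OF _ assms(4)])
        show "(\<lambda>u. y(j := u, i := t - (u + (\<Sum>r\<in>K. y r)))) \<in> borel \<rightarrow>\<^sub>M PiM I (\<lambda>_. borel)"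
        proof (rule measurable_fun_upd[where J = "insert j K"])
          show "(\<lambda>u. y(j := u)) \<in> borel \<rightarrow>\<^sub>M PiM (insert j K) (\<lambda>_. borel)"
            using y by (intro measurable_fun_upd[where J = K] measurable_const) (auto simp: space_PiM)
        qed (use K in auto)
      qed
      show ?thesis
      using False by (subst nn_integral_real_affine[where c = "-1" and t = "t - (\<Sum>r\<in>K. y r)"])
        (auto simp: fun_upd_twist algebra_simps)
    qed
  qed
  also have "\<dots> = (\<integral>\<^sup>+y. H (y(j := t - (\<Sum>r\<in>I - {j}. y r))) \<partial>PiM (I - {j}) (\<lambda>_. lborel))"
    unfolding K(5) using K False by (subst product_nn_integral_insert) (auto simp: ne cong: sum.cong)
  finally show ?thesis .
qed simp


text \<open>
  The map from the first three sojourn times to the position is affine and triangular: \<open>x $ 1\<close> depends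
  on the first time only, \<open>x $ 2\<close> on the first two. Substituting one coordinate after the other
  produces the Jacobian as the product of the three slopes, and it equals \<open>det (dir_matrix c)\<close>.
\<close>

lemma point_integral_substitution:
  fixes f :: "real ^ 3 \<Rightarrow> ennreal"
  assumes [measurable]: "f \<in> borel_measurable borel" and c: "c > 0"
  shows "(\<integral>\<^sup>+x. f x \<partial>lborel) = ennreal (16 * sqrt 3 / 9 * c ^ 3) *
    (\<integral>\<^sup>+y. f (point c (y(4 := t - (\<Sum>r\<in>{1..4} - {4}. y r)))) \<partial>PiM ({1..4} - {4}) (\<lambda>_. lborel))"
proof -
  note [measurable] = borel_measurable_vector3
  have [measurable (raw)]: "(\<lambda>x. f (vector [a x, b x, d x])) \<in> borel_measurable N"
    if [measurable]: "a \<in> borel_measurable N" "b \<in> borel_measurable N" "d \<in> borel_measurable N"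
    for a b d and N :: "'z measure"
  proof -
    have "(\<lambda>x. f (case (a x, b x, d x) of (u, v, w) \<Rightarrow> vector [u, v, w])) \<in> borel_measurable N"
      by measurable
    then show ?thesis by simp
  qed
  \<comment> \<open>X, Y, Z solve the equations for tau in terms of x, one coordinate at a time\<close>
  define X where "X u = c * (- t / 3) + 4 * c / 3 * u" for u :: real
  define Y where "Y u v = (X u - c * t) / (2 * sqrt 2) + 4 * c / (2 * sqrt 2) * v" for u v :: real
  define Z where "Z u v w = (X u + sqrt 2 * Y u v - c * t) / sqrt 6 + 4 * c / sqrt 6 * w" for u v w :: real
  have [measurable (raw)]: "(\<lambda>x. X (a x)) \<in> borel_measurable N"
      "(\<lambda>x. Y (a x) (b x)) \<in> borel_measurable N"
      "(\<lambda>x. Z (a x) (b x) (d x)) \<in> borel_measurable N"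
    if [measurable]: "a \<in> borel_measurable N" "b \<in> borel_measurable N" "d \<in> borel_measurable N"
    for a b d and N :: "'z measure" unfolding X_def Y_def Z_def by measurable
  have vec: "vector [X u, Y u v, Z u v w] =
     point c (y(4 := t - (\<Sum>r\<in>{1..4} - {4}. y r)))" if "y 1 = u" "y 2 = v" "y 3 = w" for u v w y
  proof -
    have "{1..4} - {4} = {1, 2, 3::nat}" by auto
    then have s: "(\<Sum>r\<in>{1..4} - {4}. y r) = u + v + w" using that by simp
    show ?thesis
      unfolding vec_eq_iff forall_3 point_nth s using that
      by (simp add: X_def Y_def Z_def sqrt_collapse field_simps)
  qed
  have inner2: "(\<integral>\<^sup>+v. \<integral>\<^sup>+w. f (vector [X u, v, w]) \<partial>lborel \<partial>lborel) =
      ennreal (4 * c / (2 * sqrt 2)) * (\<integral>\<^sup>+v. \<integral>\<^sup>+w. f (vector [X u, Y u v, w]) \<partial>lborel \<partial>lborel)" for u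
    using c by (subst nn_integral_real_affine[where c = "4 * c / (2 * sqrt 2)" and t = "(X u - c * t) / (2 * sqrt 2)"])
      (simp_all add: Y_def)
  have inner3: "(\<integral>\<^sup>+w. f (vector [X u, Y u v, w]) \<partial>lborel) =
      ennreal (4 * c / sqrt 6) * (\<integral>\<^sup>+w. f (vector [X u, Y u v, Z u v w]) \<partial>lborel)" for u v
    using c by (subst nn_integral_real_affine[where c = "4 * c / sqrt 6" and t = "(X u + sqrt 2 * Y u v - c * t) / sqrt 6"])
      (simp_all add: Z_def)
  have "(\<integral>\<^sup>+x. f x \<partial>lborel) = (\<integral>\<^sup>+u. \<integral>\<^sup>+v. \<integral>\<^sup>+w. f (vector [u, v, w]) \<partial>lborel \<partial>lborel \<partial>lborel)"
    by (rule nn_integral_real3) measurable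
  also have "\<dots> = ennreal (4 * c / 3) * (\<integral>\<^sup>+u. \<integral>\<^sup>+v. \<integral>\<^sup>+w. f (vector [X u, v, w]) \<partial>lborel \<partial>lborel \<partial>lborel)"
    using c by (subst nn_integral_real_affine[where c = "4 * c / 3" and t = "c * (- t / 3)"]) (simp_all add: X_def)
  also have "\<dots> = ennreal (4 * c / 3) * (\<integral>\<^sup>+u. ennreal (4 * c / (2 * sqrt 2)) *
     (\<integral>\<^sup>+v. \<integral>\<^sup>+w. f (vector [X u, Y u v, w]) \<partial>lborel \<partial>lborel) \<partial>lborel)"
    unfolding inner2 ..
  also have "\<dots> = ennreal (4 * c / 3) * (\<integral>\<^sup>+u. ennreal (4 * c / (2 * sqrt 2)) *
     (\<integral>\<^sup>+v. ennreal (4 * c / sqrt 6) * (\<integral>\<^sup>+w. f (vector [X u, Y u v, Z u v w]) \<partial>lborel) \<partial>lborel) \<partial>lborel)"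
    unfolding inner3 ..
  also have "\<dots> = ennreal (4 * c / 3) * (ennreal (4 * c / (2 * sqrt 2)) * (ennreal (4 * c / sqrt 6) *
     (\<integral>\<^sup>+u. \<integral>\<^sup>+v. \<integral>\<^sup>+w. f (vector [X u, Y u v, Z u v w]) \<partial>lborel \<partial>lborel \<partial>lborel)))"
    by (simp add: nn_integral_cmult)
  also have "\<dots> = ennreal (16 * sqrt 3 / 9 * c ^ 3) *
     (\<integral>\<^sup>+u. \<integral>\<^sup>+v. \<integral>\<^sup>+w. f (vector [X u, Y u v, Z u v w]) \<partial>lborel \<partial>lborel \<partial>lborel)"
  proof -
    have "16 * sqrt 3 / 9 * c ^ 3 = (4 * c / 3) * ((4 * c / (2 * sqrt 2)) * (4 * c / sqrt 6))"
      by (simp add: sqrt_collapse field_simps power3_eq_cube)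
    then have "ennreal (16 * sqrt 3 / 9 * c ^ 3) =
        ennreal (4 * c / 3) * (ennreal (4 * c / (2 * sqrt 2)) * ennreal (4 * c / sqrt 6))"
      using c by (simp only:) (subst ennreal_mult; simp flip: ennreal_mult)
    then show ?thesis by (simp only: mult.assoc)
  qed
  also have "(\<integral>\<^sup>+u. \<integral>\<^sup>+v. \<integral>\<^sup>+w. f (vector [X u, Y u v, Z u v w]) \<partial>lborel \<partial>lborel \<partial>lborel) =
    (\<integral>\<^sup>+y. f (vector [X (y 1), Y (y 1) (y 2), Z (y 1) (y 2) (y 3)]) \<partial>PiM {1, 2, 3 :: nat} (\<lambda>_. lborel))"
    by (rule nn_integral_PiM_123[symmetric]) (simp add: split_def)
  also have "{1, 2, 3 :: nat} = {1..4} - {4}" by auto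
  finally show ?thesis unfolding vec[OF refl refl refl] .
qed

section \<open>Waiting times of a geometric counting process\<close>

text \<open>
  The density of the \<open>k\<close>-th event time of a geometric counting process with intensity \<open>l\<close>. It vanishes
  identically for \<open>k = 0\<close>, where the event time is the constant 0: a direction
  that has not been taken yet keeps the particle on the boundary of the tetrahedron, which
  contributes nothing to the density inside.
\<close>

definition gcp_density :: "real \<Rightarrow> nat \<Rightarrow> real \<Rightarrow> real" where
  "gcp_density l k y =
     (if y \<le> 0 then 0 else real k * l ^ k * y ^ (k - 1) / (1 + l * y) ^ (k + 1))"

lemma gcp_density_nonneg: "l > 0 \<Longrightarrow> 0 \<le> gcp_density l k y"
  by (simp add: gcp_density_def)

lemma borel_measurable_gcp_density [measurable]: "gcp_density l k \<in> borel_measurable borel"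
  unfolding gcp_density_def by measurable

lemma borel_measurable_erlang_density_pair [measurable (raw)]:
  assumes [measurable]: "f \<in> borel_measurable N" "g \<in> borel_measurable N"
  shows "(\<lambda>x. erlang_density k (f x) (g x)) \<in> borel_measurable N"
  unfolding erlang_density_def by measurable

text \<open>
  As a function of the intensity \<open>a\<close>, the integrand is proportional to an Erlang density with rate
  \<open>1 / l + y\<close>; the constant of proportionality is the value of the integral.
\<close>

lemma exponential_mixture_of_erlang:
  assumes l: "l > 0" and y: "y > 0"
  shows "(\<integral>\<^sup>+a. ennreal (exponential_density (1 / l) a) * ennreal (erlang_density m a y) \<partial>lborel)
    = ennreal (gcp_density l (Suc m) y)"
proof -
  have pos: "1 / l + y > 0" using l y by (simp add: add_pos_pos)
  have "exponential_density (1 / l) a * erlang_density m a y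
      = gcp_density l (Suc m) y * erlang_density (Suc m) (1 / l + y) a" for a
  proof (cases "a < 0")
    case False
    have q: "1 + l * y \<noteq> 0" and b: "1 / l + y = (1 + l * y) / l"
      using l y by (simp_all add: add_pos_pos less_imp_neq[symmetric] field_simps)
    have "gcp_density l (Suc m) y * (1 / l + y) ^ Suc (Suc m) = real (Suc m) * y ^ m / l"
      using l y q unfolding gcp_density_def b by (simp add: power_divide)
    moreover have "erlang_density (Suc m) (1 / l + y) a = (1 / l + y) ^ Suc (Suc m) *
        (a ^ Suc m * exp (- (1 / l + y) * a) / fact (Suc m))"
      using False by (simp add: erlang_density_def del: fact_Suc power_Suc)
    ultimately have "gcp_density l (Suc m) y * erlang_density (Suc m) (1 / l + y) a =
        real (Suc m) * y ^ m / l * (a ^ Suc m * exp (- (1 / l + y) * a) / fact (Suc m))"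
      by (simp only: mult.assoc[symmetric])
    also have "\<dots> = y ^ m / l * (a ^ Suc m * exp (- (1 / l + y) * a) / fact m)"
      by simp
    also have "exp (- (1 / l + y) * a) = exp (- a / l) * exp (- a * y)"
      by (simp add: field_simps flip: exp_add)
    finally show ?thesis
      using False l y by (simp add: erlang_density_def mult_ac)
  qed (simp add: erlang_density_def)
  then have "(\<integral>\<^sup>+a. ennreal (exponential_density (1 / l) a) * ennreal (erlang_density m a y) \<partial>lborel)
    = (\<integral>\<^sup>+a. ennreal (gcp_density l (Suc m) y) * ennreal (erlang_density (Suc m) (1 / l + y) a) \<partial>lborel)"
    using l pos by (intro nn_integral_cong) (auto simp: erlang_density_def gcp_density_nonneg simp flip: ennreal_mult'' ennreal_mult')
  also have "\<dots> = ennreal (gcp_density l (Suc m) y)"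
    using nn_integral_erlang_ith_moment[OF pos, of "Suc m" 0] by (simp add: nn_integral_cmult)
  finally show ?thesis .
qed

text \<open>
  The joint law of interarrival times with a common random rate, realised as unit exponentials divided
  by an independent exponential rate. Writing the mixture as an image of a product measure avoids
  having to show that the conditional laws depend measurably on the rate.
\<close>

definition gcp_mixture :: "real \<Rightarrow> nat set \<Rightarrow> (nat \<Rightarrow> real) measure" where
  "gcp_mixture l I =
    distr (density lborel (exponential_density (1 / l)) \<Otimes>\<^sub>M PiM I (\<lambda>_. density lborel (exponential_density 1)))
      (PiM I (\<lambda>_. borel)) (\<lambda>(a, u). \<lambda>k\<in>I. u k / a)"

lemma emeasure_gcp_mixture:
  assumes "l > 0" "finite I" and [measurable]: "A \<in> sets (PiM I (\<lambda>_. borel))"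
  shows "emeasure (gcp_mixture l I) A = (\<integral>\<^sup>+a. exponential_density (1 / l) a *
    emeasure (PiM I (\<lambda>_. density lborel (exponential_density 1)))
      {u \<in> space (PiM I (\<lambda>_. borel)). (\<lambda>k\<in>I. u k / a) \<in> A} \<partial>lborel)"
proof -
  interpret e: prob_space "density lborel (exponential_density 1)"
    by (rule prob_space_exponential_density) simp
  interpret p: prob_space "PiM I (\<lambda>_. density lborel (exponential_density 1))"
    by (intro prob_space_PiM e.prob_space_axioms)
  have sets: "sets (PiM I (\<lambda>_. density lborel (exponential_density 1))) = sets (PiM I (\<lambda>_. borel))"
    by (intro sets_PiM_cong) auto
  note [measurable_cong] = sets
  have space: "space (PiM I (\<lambda>_. density lborel (exponential_density 1))) = space (PiM I (\<lambda>_. borel))"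
    by (simp add: space_PiM)
  have [measurable]: "(\<lambda>(a, u). \<lambda>k\<in>I. u k / a) \<in>
    density lborel (exponential_density (1 / l)) \<Otimes>\<^sub>M PiM I (\<lambda>_. density lborel (exponential_density 1))
      \<rightarrow>\<^sub>M PiM I (\<lambda>_. borel)"
    unfolding split_def by measurable
  show ?thesis
    unfolding gcp_mixture_def
    by (subst emeasure_distr, measurable, subst p.emeasure_pair_measure_alt)
      (auto simp: nn_integral_density space_pair_measure space intro!: nn_integral_cong arg_cong2[where f = "(*)"] arg_cong2[where f = emeasure])
qed

context prob_space
begin

lemma gcp_intensity:
  assumes "gcp_interarrivals M l a E"
  shows "a \<in> borel_measurable M" "distributed M lborel a (exponential_density (1 / l))"
  using assms distributed_measurable[of M lborel a] by (auto simp: gcp_interarrivals_def)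

lemma gcp_interarrival_measurable:
  "gcp_interarrivals M l a E \<Longrightarrow> k \<ge> 1 \<Longrightarrow> E k \<in> borel_measurable M"
  by (auto simp: gcp_interarrivals_def)

text \<open>
  Integrating the conditional probability of a rectangle over the whole space gives its probability,
  and the intensity is then integrated against its exponential law.
\<close>

lemma gcp_rectangle_probability:
  assumes gcp: "gcp_interarrivals M l a E" and l: "l > 0"
    and B [measurable]: "\<And>k. k \<in> {1..n} \<Longrightarrow> B k \<in> sets borel"
  shows "emeasure M {\<omega> \<in> space M. \<forall>k\<in>{1..n}. E k \<omega> \<in> B k} =
    (\<integral>\<^sup>+x. exponential_density (1 / l) x *
      (\<Prod>k\<in>{1..n}. emeasure (density lborel (exponential_density x)) (B k)) \<partial>lborel)"
proof -
  note [measurable] = gcp_intensity(1)[OF gcp]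
  have E [measurable]: "E k \<in> borel_measurable M" if "k \<in> {1..n}" for k
    using gcp_interarrival_measurable[OF gcp] that by simp
  define S where "S = {\<omega> \<in> space M. \<forall>k\<in>{1..n}. E k \<omega> \<in> B k}"
  have S [measurable]: "S \<in> sets M" unfolding S_def by measurable
  define F where "F = vimage_algebra (space M) a borel"
  have sub: "subalgebra M F"
    unfolding subalgebra_def F_def
    by (auto simp: sets_vimage_algebra2 measurable_sets[OF gcp_intensity(1)[OF gcp]])
  interpret finite_measure_subalgebra M F by unfold_locales (rule sub)
  define g where "g x = (\<Prod>k\<in>{1..n}. measure (density lborel (\<lambda>y. ennreal (exponential_density x y))) (B k))" for x
  have g_nonneg: "g x \<ge> 0" for x unfolding g_def by (intro prod_nonneg) auto
  have [measurable]: "g \<in> borel_measurable borel"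
  proof -
    have "(\<lambda>x. measure (density lborel (\<lambda>y. ennreal (exponential_density x y))) (B k)) \<in> borel_measurable borel"
      if "k \<in> {1..n}" for k
    proof -
      have [measurable]: "B k \<in> sets borel" by (rule B[OF that])
      show ?thesis by (simp add: measure_def emeasure_density)
    qed
    then show ?thesis unfolding g_def by measurable
  qed
  have ae: "AE \<omega> in M. real_cond_exp M F (indicator S) \<omega> = g (a \<omega>)"
    using gcp B unfolding gcp_interarrivals_def F_def S_def g_def by blast
  have int: "integrable M (indicator S :: _ \<Rightarrow> real)" by (simp add: emeasure_eq_measure)
  have ig: "integrable M (\<lambda>\<omega>. g (a \<omega>))"
    by (rule integrable_cong_AE_imp[OF real_cond_exp_int(1)[OF int]]) (use ae in auto)
  have "prob S = (\<integral>\<omega>. indicator S \<omega> \<partial>M)" by simp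
  also have "\<dots> = (\<integral>\<omega>. real_cond_exp M F (indicator S) \<omega> \<partial>M)"
    using real_cond_exp_int(2)[OF int] by simp
  also have "\<dots> = (\<integral>\<omega>. g (a \<omega>) \<partial>M)"
    by (intro integral_cong_AE ae) auto
  finally have "emeasure M S = (\<integral>\<^sup>+\<omega>. g (a \<omega>) \<partial>M)"
    using ig g_nonneg by (simp add: emeasure_eq_measure nn_integral_eq_integral)
  also have "\<dots> = (\<integral>\<^sup>+x. ennreal (exponential_density (1 / l) x) * ennreal (g x) \<partial>lborel)"
    using distributed_nn_integral[OF gcp_intensity(2)[OF gcp], of "\<lambda>x. ennreal (g x)"] by simp
  \<comment> \<open>the exponential law is a probability measure for positive rates only; negative rates have density 0\<close>
  also have "\<dots> = (\<integral>\<^sup>+x. exponential_density (1 / l) x *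
      (\<Prod>k\<in>{1..n}. emeasure (density lborel (exponential_density x)) (B k)) \<partial>lborel)"
  proof (rule nn_integral_cong_AE, rule AE_mp[OF AE_lborel_singleton[of 0]], rule AE_I2, rule impI)
    fix x :: real assume "x \<noteq> 0"
    then consider "x < 0" | "x > 0" by linarith
    then show "ennreal (exponential_density (1 / l) x) * ennreal (g x) = ennreal (exponential_density (1 / l) x) *
      (\<Prod>k\<in>{1..n}. emeasure (density lborel (exponential_density x)) (B k))"
    proof cases
      case 2
      interpret e: prob_space "density lborel (exponential_density x)"
        by (rule prob_space_exponential_density) fact
      show ?thesis unfolding g_def e.emeasure_eq_measure by (subst prod_ennreal) auto
    qed (simp add: erlang_density_def)
  qed
  finally show ?thesis unfolding S_def .
qed

text \<open>
  Both measures agree on rectangles, because a unit exponential divided by \<open>x\<close> is exponential with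
  rate \<open>x\<close>.
\<close>

lemma gcp_joint_law:
  assumes gcp: "gcp_interarrivals M l a E" and l: "l > 0"
  shows "distr M (PiM {1..n} (\<lambda>_. borel)) (\<lambda>\<omega>. \<lambda>k\<in>{1..n}. E k \<omega>) = gcp_mixture l {1..n}"
proof (rule measure_eqI_PiM_finite[where I = "{1..n}" and A = "\<lambda>_. space (PiM {1..n} (\<lambda>_. borel))"])
  have E [measurable]: "E k \<in> borel_measurable M" if "k \<in> {1..n}" for k
    using gcp_interarrival_measurable[OF gcp] that by simp
  have E': "(\<lambda>\<omega>. \<lambda>k\<in>{1..n}. E k \<omega>) \<in> M \<rightarrow>\<^sub>M PiM {1..n} (\<lambda>_. borel)" by measurable
  interpret e: prob_space "density lborel (exponential_density 1)"
    by (rule prob_space_exponential_density) simp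
  interpret p: product_prob_space "\<lambda>_ :: nat. density lborel (exponential_density 1)" ..
  fix B :: "nat \<Rightarrow> real set" assume B: "B k \<in> sets borel" if "k \<in> {1..n}" for k
  have PB [measurable]: "Pi\<^sub>E {1..n} B \<in> sets (PiM {1..n} (\<lambda>_. borel))"
    by (intro sets_PiM_I_finite B) auto
  have "emeasure (distr M (PiM {1..n} (\<lambda>_. borel)) (\<lambda>\<omega>. \<lambda>k\<in>{1..n}. E k \<omega>)) (Pi\<^sub>E {1..n} B)
     = emeasure M {\<omega> \<in> space M. \<forall>k\<in>{1..n}. E k \<omega> \<in> B k}"
    by (subst emeasure_distr[OF E' PB]) (auto simp: PiE_iff intro!: arg_cong2[where f = emeasure])
  also have "\<dots> = (\<integral>\<^sup>+x. exponential_density (1 / l) x *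
      (\<Prod>k\<in>{1..n}. emeasure (density lborel (exponential_density x)) (B k)) \<partial>lborel)"
    by (rule gcp_rectangle_probability[OF gcp l B])
  also have "\<dots> = emeasure (gcp_mixture l {1..n}) (Pi\<^sub>E {1..n} B)"
    unfolding emeasure_gcp_mixture[OF l finite_atLeastAtMost \<open>Pi\<^sub>E {1..n} B \<in> _\<close>]
  proof (rule nn_integral_cong_AE, rule AE_mp[OF AE_lborel_singleton[of 0]], rule AE_I2, rule impI)
    fix x :: real assume "x \<noteq> 0"
    then consider "x < 0" | "x > 0" by linarith
    then show "ennreal (exponential_density (1 / l) x) *
        (\<Prod>k\<in>{1..n}. emeasure (density lborel (exponential_density x)) (B k)) =
       ennreal (exponential_density (1 / l) x) *
         emeasure (PiM {1..n} (\<lambda>_. density lborel (exponential_density 1)))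
          {u \<in> space (PiM {1..n} (\<lambda>_. borel)). (\<lambda>k\<in>{1..n}. u k / x) \<in> Pi\<^sub>E {1..n} B}"
    proof cases
      case 2
      have "{u \<in> space (PiM {1..n} (\<lambda>_. borel)). (\<lambda>k\<in>{1..n}. u k / x) \<in> Pi\<^sub>E {1..n} B} =
          Pi\<^sub>E {1..n} (\<lambda>k. {v. v / x \<in> B k})"
        by (auto simp: space_PiM PiE_iff extensional_def)
      moreover have "emeasure (density lborel (exponential_density 1)) {v. v / x \<in> B k}
          = emeasure (density lborel (exponential_density x)) (B k)" if "k \<in> {1..n}" for k
      proof -
        have [measurable]: "B k \<in> sets borel" by (rule B[OF that])
        have "distributed (density lborel (exponential_density 1)) lborel (\<lambda>v. v) (exponential_density 1)"
          by (auto simp: distributed_def distr_id2)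
        from e.erlang_distributed_mult_const[OF this, of "1 / x"] 2
        have "distributed (density lborel (exponential_density 1)) lborel (\<lambda>v. v / x) (exponential_density x)"
          by simp
        from distributed_emeasure[OF this, of "B k"] show ?thesis
          by (simp add: emeasure_density vimage_def)
      qed
      moreover have "{v. v / x \<in> B k} \<in> sets borel" if "k \<in> {1..n}" for k
      proof -
        have [measurable]: "B k \<in> sets borel" by (rule B[OF that])
        show ?thesis by measurable
      qed
      ultimately show ?thesis
        using p.emeasure_PiM[of "{1..n}" "\<lambda>k. {v. v / x \<in> B k}"] by simp
    qed (simp add: erlang_density_def)
  qed
  finally show "emeasure (distr M (PiM {1..n} (\<lambda>_. borel)) (\<lambda>\<omega>. \<lambda>k\<in>{1..n}. E k \<omega>)) (Pi\<^sub>E {1..n} B)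
     = emeasure (gcp_mixture l {1..n}) (Pi\<^sub>E {1..n} B)" .
next
  have E [measurable]: "E k \<in> borel_measurable M" if "k \<in> {1..n}" for k
    using gcp_interarrival_measurable[OF gcp] that by simp
  have E': "(\<lambda>\<omega>. \<lambda>k\<in>{1..n}. E k \<omega>) \<in> M \<rightarrow>\<^sub>M PiM {1..n} (\<lambda>_. borel)" by measurable
  interpret d: prob_space "distr M (PiM {1..n} (\<lambda>_. borel)) (\<lambda>\<omega>. \<lambda>k\<in>{1..n}. E k \<omega>)"
    by (rule prob_space_distr[OF E'])
  show "emeasure (distr M (PiM {1..n} (\<lambda>_. borel)) (\<lambda>\<omega>. \<lambda>k\<in>{1..n}. E k \<omega>))
      (space (PiM {1..n} (\<lambda>_. borel))) \<noteq> \<infinity>" for i :: nat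
    using d.emeasure_finite[of "space (PiM {1..n} (\<lambda>_. borel))"] by simp
  show "range (\<lambda>_. space (PiM {1..n} (\<lambda>_. borel :: real measure))) \<subseteq> prod_algebra {1..n} (\<lambda>_. borel)"
    by (auto simp: space_PiM intro!: prod_algebraI_finite)
qed (auto simp: gcp_mixture_def)

lemma indep_vars_coordinates:
  assumes N: "prob_space N" and I: "finite I" "I \<noteq> {}"
  shows "prob_space.indep_vars (PiM I (\<lambda>_. N)) (\<lambda>_. N) (\<lambda>i u. u i) I"
proof -
  interpret P: prob_space "PiM I (\<lambda>_. N)" by (intro prob_space_PiM N)
  have "distr (PiM I (\<lambda>_. N)) (PiM I (\<lambda>_. N)) (\<lambda>u. \<lambda>i\<in>I. u i) = PiM I (\<lambda>_. N)"
    by (subst distr_cong[where g = "\<lambda>u. u" and K = "PiM I (\<lambda>_. N)"])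
      (auto simp: space_PiM PiE_restrict distr_id2)
  moreover have "distr (PiM I (\<lambda>_. N)) N (\<lambda>u. u i) = N" if "i \<in> I" for i
    using distr_PiM_component[of I "\<lambda>_. N" i] N that by simp
  ultimately show ?thesis
    using I by (subst P.indep_vars_iff_distr_eq_PiM') (auto intro!: PiM_cong)
qed

lemma scaled_exponentials_sum:
  assumes a: "a > 0" and I: "finite I" "I \<noteq> {}"
  shows "distributed (PiM I (\<lambda>_. density lborel (exponential_density 1))) lborel
    (\<lambda>u. \<Sum>k\<in>I. u k / a) (erlang_density (card I - 1) a)"
proof -
  let ?N = "density lborel (exponential_density 1)"
  interpret N: prob_space ?N by (rule prob_space_exponential_density) simp
  interpret P: prob_space "PiM I (\<lambda>_. ?N)" by (intro prob_space_PiM N.prob_space_axioms)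
  show ?thesis
  proof (rule P.exponential_distributed_sum[OF I a])
    fix k assume k: "k \<in> I"
    have "distr (PiM I (\<lambda>_. ?N)) lborel (\<lambda>u. u k) = distr (PiM I (\<lambda>_. ?N)) ?N (\<lambda>u. u k)"
      by (rule distr_cong) auto
    also have "\<dots> = ?N"
      using distr_PiM_component[of I "\<lambda>_. ?N" k] k N.prob_space_axioms by simp
    finally have "distributed (PiM I (\<lambda>_. ?N)) lborel (\<lambda>u. u k) (exponential_density 1)"
      using k by (simp add: distributed_def)
    from P.erlang_distributed_mult_const[OF this, of "1 / a"] a
    show "distributed (PiM I (\<lambda>_. ?N)) lborel (\<lambda>u. u k / a) (exponential_density a)"
      by simp
  next
    show "P.indep_vars (\<lambda>_. borel) (\<lambda>k u. u k / a) I"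
      by (rule P.indep_vars_compose2[OF indep_vars_coordinates[OF N.prob_space_axioms I]]) simp
  qed
qed

text \<open>
  Conditionally on the rate the waiting time is a sum of independent exponentials, hence Erlang;
  Fubini then integrates out the rate.
\<close>

lemma gcp_waiting_time_distributed:
  assumes gcp: "gcp_interarrivals M l a E" and l: "l > 0" and n: "n \<ge> 1"
  shows "distributed M lborel (\<lambda>\<omega>. \<Sum>k = 1..n. E k \<omega>) (gcp_density l n)"
proof -
  have E [measurable]: "E k \<in> borel_measurable M" if "k \<in> {1..n}" for k
    using gcp_interarrival_measurable[OF gcp] that by simp
  have E': "(\<lambda>\<omega>. \<lambda>k\<in>{1..n}. E k \<omega>) \<in> M \<rightarrow>\<^sub>M PiM {1..n} (\<lambda>_. borel)" by measurable
  obtain m where m: "n = Suc m" using n by (cases n) auto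
  let ?P = "PiM {1..n} (\<lambda>_. density lborel (exponential_density 1))"
  have "distr M lborel (\<lambda>\<omega>. \<Sum>k = 1..n. E k \<omega>) = density lborel (gcp_density l n)"
  proof (rule measure_eqI)
    fix A assume "A \<in> sets (distr M lborel (\<lambda>\<omega>. \<Sum>k = 1..n. E k \<omega>))"
    then have A [measurable]: "A \<in> sets borel" by simp
    let ?A = "{x \<in> space (PiM {1..n} (\<lambda>_. borel)). (\<Sum>k = 1..n. x k) \<in> A}"
    have A' [measurable]: "?A \<in> sets (PiM {1..n} (\<lambda>_. borel))" by measurable
    have "emeasure (distr M lborel (\<lambda>\<omega>. \<Sum>k = 1..n. E k \<omega>)) A =
        emeasure (distr M (PiM {1..n} (\<lambda>_. borel)) (\<lambda>\<omega>. \<lambda>k\<in>{1..n}. E k \<omega>)) ?A"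
      by (subst emeasure_distr[OF E' A'], subst emeasure_distr)
        (auto simp: space_PiM intro!: arg_cong2[where f = emeasure])
    also have "\<dots> = (\<integral>\<^sup>+x. exponential_density (1 / l) x *
        emeasure ?P {u \<in> space (PiM {1..n} (\<lambda>_. borel)). (\<lambda>k\<in>{1..n}. u k / x) \<in> ?A} \<partial>lborel)"
      unfolding gcp_joint_law[OF gcp l] using l by (subst emeasure_gcp_mixture) auto
    also have "\<dots> = (\<integral>\<^sup>+x. exponential_density (1 / l) x *
        (\<integral>\<^sup>+y. ennreal (erlang_density m x y) * indicator A y \<partial>lborel) \<partial>lborel)"
    proof (rule nn_integral_cong_AE, rule AE_mp[OF AE_lborel_singleton[of 0]], rule AE_I2, rule impI)
      fix x :: real assume "x \<noteq> 0"
      then consider "x < 0" | "x > 0" by linarith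
      then show "ennreal (exponential_density (1 / l) x) *
          emeasure ?P {u \<in> space (PiM {1..n} (\<lambda>_. borel)). (\<lambda>k\<in>{1..n}. u k / x) \<in> ?A} =
        ennreal (exponential_density (1 / l) x) *
          (\<integral>\<^sup>+y. ennreal (erlang_density m x y) * indicator A y \<partial>lborel)"
      proof cases
        case 2
        have "{u \<in> space (PiM {1..n} (\<lambda>_. borel)). (\<lambda>k\<in>{1..n}. u k / x) \<in> ?A} =
            (\<lambda>u. \<Sum>k = 1..n. u k / x) -` A \<inter> space ?P"
          by (auto simp: space_PiM)
        with distributed_emeasure[OF scaled_exponentials_sum[OF 2, of "{1..n}"], of A]
        show ?thesis by (simp add: m)
      qed (simp add: erlang_density_def)
    qed
    \<comment> \<open>Fubini: the rate is integrated out before the waiting time\<close>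
    also have "\<dots> = (\<integral>\<^sup>+x. \<integral>\<^sup>+y. ennreal (exponential_density (1 / l) x) *
        (ennreal (erlang_density m x y) * indicator A y) \<partial>lborel \<partial>lborel)"
      by (subst nn_integral_cmult) auto
    also have "\<dots> = (\<integral>\<^sup>+y. \<integral>\<^sup>+x. ennreal (exponential_density (1 / l) x) *
        (ennreal (erlang_density m x y) * indicator A y) \<partial>lborel \<partial>lborel)"
      by (rule lborel_pair.Fubini') measurable
    also have "\<dots> = (\<integral>\<^sup>+y. (\<integral>\<^sup>+x. ennreal (exponential_density (1 / l) x) *
        ennreal (erlang_density m x y) \<partial>lborel) * indicator A y \<partial>lborel)"
      by (simp add: nn_integral_multc flip: mult.assoc)
    also have "\<dots> = (\<integral>\<^sup>+y. ennreal (gcp_density l n y) * indicator A y \<partial>lborel)"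
    proof (rule nn_integral_cong_AE, rule AE_mp[OF AE_lborel_singleton[of 0]], rule AE_I2, rule impI)
      fix y :: real assume "y \<noteq> 0"
      then consider "y < 0" | "y > 0" by linarith
      then show "(\<integral>\<^sup>+x. ennreal (exponential_density (1 / l) x) * ennreal (erlang_density m x y) \<partial>lborel)
          * indicator A y = ennreal (gcp_density l n y) * indicator A y"
      proof cases
        case 1
        then show ?thesis by (simp add: erlang_density_def gcp_density_def)
      next
        case 2
        then show ?thesis using exponential_mixture_of_erlang[OF l 2, of m] by (simp add: m)
      qed
    qed
    also have "\<dots> = emeasure (density lborel (gcp_density l n)) A"
      by (simp add: emeasure_density)
    finally show "emeasure (distr M lborel (\<lambda>\<omega>. \<Sum>k = 1..n. E k \<omega>)) A =
        emeasure (density lborel (gcp_density l n)) A" .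
  qed simp
  then show ?thesis by (simp add: distributed_def)
qed

lemma gcp_waiting_time_cdf:
  assumes gcp: "gcp_interarrivals M l a E" and l: "l > 0" and s: "s \<ge> 0"
  shows "prob {\<omega> \<in> space M. (\<Sum>k = 1..n. E k \<omega>) \<le> s} = (l * s / (1 + l * s)) ^ n"
proof (cases n)
  case 0
  with s show ?thesis by (simp add: prob_space)
next
  case (Suc m)
  have pos: "1 + l * y > 0" if "0 \<le> y" for y using l that by (simp add: add_pos_nonneg)
  have "emeasure M {\<omega> \<in> space M. (\<Sum>k = 1..n. E k \<omega>) \<le> s}
      = (\<integral>\<^sup>+y. ennreal (gcp_density l n y) * indicator {..s} y \<partial>lborel)"
    using distributed_emeasure[OF gcp_waiting_time_distributed[OF gcp l, of n], of "{..s}"] Suc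
    by (simp add: vimage_def Int_def conj_commute)
  also have "\<dots> = (\<integral>\<^sup>+y. ennreal (real n * l ^ n * y ^ m / (1 + l * y) ^ (n + 1)) * indicator {0..s} y \<partial>lborel)"
    by (rule nn_integral_cong_AE, rule AE_mp[OF AE_lborel_singleton[of 0]], rule AE_I2)
      (auto simp: gcp_density_def Suc split: split_indicator)
  also have "\<dots> = ennreal ((l * s / (1 + l * s)) ^ n - (l * 0 / (1 + l * 0)) ^ n)"
  proof (rule nn_integral_FTC_Icc)
    fix y assume "y \<in> {0..s}"
    then have y: "0 \<le> y" "y \<le> s" by auto
    show "DERIV (\<lambda>y. (l * y / (1 + l * y)) ^ n) y :> real n * l ^ n * y ^ m / (1 + l * y) ^ (n + 1)"
    proof -
      have q: "1 + l * y \<noteq> 0" using pos[OF y(1)] by simp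
      have "DERIV (\<lambda>y. l * y / (1 + l * y)) y :> l / (1 + l * y) ^ 2"
        using q by (auto intro!: derivative_eq_intros simp: power2_eq_square) (simp add: algebra_simps)
      from DERIV_power[OF this, of n]
      have "DERIV (\<lambda>y. (l * y / (1 + l * y)) ^ n) y :> real n * (l / (1 + l * y) ^ 2 * (l * y / (1 + l * y)) ^ m)"
        by (simp add: Suc)
      also have "real n * (l / (1 + l * y) ^ 2 * (l * y / (1 + l * y)) ^ m) =
          real n * l ^ n * y ^ m / (1 + l * y) ^ (n + 1)"
        by (simp add: Suc power_divide power_mult_distrib power2_eq_square mult_ac)
      finally show ?thesis .
    qed
    show "0 \<le> real n * l ^ n * y ^ m / (1 + l * y) ^ (n + 1)"
      using l y by simp
  qed (use s in auto)
  finally show ?thesis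
    using l s by (simp add: emeasure_eq_measure Suc)
qed

text \<open>
  For almost every rate the conditional law of the interarrival time gives no mass to the negative
  half-line, so the rectangle that constrains only the \<open>n\<close>-th factor is null.
\<close>

lemma gcp_interarrival_pos:
  assumes gcp: "gcp_interarrivals M l a E" and l: "l > 0" and n: "n \<ge> 1"
  shows "AE \<omega> in M. E n \<omega> > 0"
proof -
  have [measurable]: "E n \<in> borel_measurable M"
    using gcp_interarrival_measurable[OF gcp n] .
  define B where "B k = (if k = n then {..0} else UNIV :: real set)" for k
  have "emeasure M {\<omega> \<in> space M. \<not> E n \<omega> > 0} = emeasure M {\<omega> \<in> space M. \<forall>k\<in>{1..n}. E k \<omega> \<in> B k}"
    using n by (intro arg_cong2[where f = emeasure]) (auto simp: B_def not_less)
  also have "\<dots> = (\<integral>\<^sup>+x. exponential_density (1 / l) x *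
      (\<Prod>k\<in>{1..n}. emeasure (density lborel (exponential_density x)) (B k)) \<partial>lborel)"
    by (rule gcp_rectangle_probability[OF gcp l]) (auto simp: B_def)
  also have "\<dots> = (\<integral>\<^sup>+x. 0 \<partial>(lborel :: real measure))"
  proof (intro nn_integral_cong)
    fix x :: real
    have "emeasure (density lborel (exponential_density x)) (B n) =
        (\<integral>\<^sup>+y. ennreal (exponential_density x y) * indicator (B n) y \<partial>lborel)"
      by (simp add: emeasure_density B_def)
    also have "\<dots> = (\<integral>\<^sup>+y. 0 \<partial>(lborel :: real measure))"
      by (rule nn_integral_cong_AE, rule AE_mp[OF AE_lborel_singleton[of 0]], rule AE_I2)
        (auto simp: B_def erlang_density_def split: split_indicator)
    finally have "(\<Prod>k\<in>{1..n}. emeasure (density lborel (exponential_density x)) (B k)) = 0"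
      using n by (intro prod_zero) auto
    then show "ennreal (exponential_density (1 / l) x) *
      (\<Prod>k\<in>{1..n}. emeasure (density lborel (exponential_density x)) (B k)) = 0" by simp
  qed
  finally show ?thesis by (subst AE_iff_measurable[OF _ refl]) auto
qed

text \<open>
  The probability that exactly \<open>n\<close> events have occurred by time \<open>s\<close>: a difference of two consecutive
  distribution functions, as waiting times increase almost surely.
\<close>

lemma gcp_count_probability:
  assumes gcp: "gcp_interarrivals M l a E" and l: "l > 0" and s: "s \<ge> 0"
  shows "prob {\<omega> \<in> space M. (\<Sum>k = 1..n. E k \<omega>) \<le> s \<and> s < (\<Sum>k = 1..n + 1. E k \<omega>)}
    = (l * s) ^ n / (1 + l * s) ^ (n + 1)"
proof -
  have E [measurable]: "E k \<in> borel_measurable M" if "k \<ge> 1" for k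
    using gcp_interarrival_measurable[OF gcp that] .
  have [measurable]: "(\<lambda>\<omega>. \<Sum>k = 1..n. E k \<omega>) \<in> borel_measurable M" for n
    by measurable
  let ?A = "\<lambda>n. {\<omega> \<in> space M. (\<Sum>k = 1..n. E k \<omega>) \<le> s}"
  have "prob {\<omega> \<in> space M. (\<Sum>k = 1..n. E k \<omega>) \<le> s \<and> s < (\<Sum>k = 1..n + 1. E k \<omega>)}
     = prob (?A n - ?A (n + 1))"
    by (intro arg_cong[where f = prob]) auto
  also have "\<dots> = prob (?A n) - prob (?A n \<inter> ?A (n + 1))"
    by (subst finite_measure_Diff') auto
  also have "prob (?A n \<inter> ?A (n + 1)) = prob (?A (n + 1))"
  proof (rule finite_measure_eq_AE)
    have "AE \<omega> in M. E (n + 1) \<omega> > 0" by (rule gcp_interarrival_pos[OF gcp l]) simp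
    then show "AE \<omega> in M. \<omega> \<in> ?A n \<inter> ?A (n + 1) \<longleftrightarrow> \<omega> \<in> ?A (n + 1)"
      by eventually_elim auto
  qed measurable
  also have "prob (?A n) - prob (?A (n + 1)) = (l * s) ^ n / (1 + l * s) ^ (n + 1)"
  proof -
    have q: "1 + l * s \<noteq> 0" using l s by (simp add: add_pos_nonneg less_imp_neq[symmetric])
    have "(l * s / (1 + l * s)) ^ n - (l * s / (1 + l * s)) ^ (n + 1)
        = (l * s / (1 + l * s)) ^ n * (1 - l * s / (1 + l * s))"
      by (simp add: algebra_simps)
    also have "1 - l * s / (1 + l * s) = 1 / (1 + l * s)"
      using q by (simp add: field_simps)
    finally show ?thesis
      unfolding gcp_waiting_time_cdf[OF gcp l s] by (simp add: power_divide)
  qed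
  finally show ?thesis .
qed

end

section \<open>Paths of the motion\<close>

text \<open>
  The number of finished sojourns in direction \<open>r\<close> just after the \<open>m\<close>-th switch.
\<close>

definition completed_sojourns :: "nat \<Rightarrow> nat \<Rightarrow> nat" where
  "completed_sojourns m r = m div 4 + (if r \<le> m mod 4 then 1 else 0)"

lemma completed_sojourns_Suc:
  assumes "r \<in> {1..4}"
  shows "completed_sojourns (Suc m) r =
    completed_sojourns m r + (if r = m mod 4 + 1 then 1 else 0)"
proof -
  have "m mod 4 = 3 \<and> Suc m mod 4 = 0 \<and> Suc m div 4 = Suc (m div 4) \<or>
    m mod 4 < 3 \<and> Suc m mod 4 = Suc (m mod 4) \<and> Suc m div 4 = m div 4"
    by presburger
  then show ?thesis
    using assms by (auto simp: completed_sojourns_def)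
qed

lemma completed_sojourns_current: "completed_sojourns m (m mod 4 + 1) = m div 4"
  by (simp add: completed_sojourns_def)

lemma current_direction: "m mod 4 + 1 \<in> {1..4 :: nat}"
proof -
  have "m mod 4 < 4" by simp
  then show ?thesis by simp
qed

lemma total_time_Suc: "total_time D r (Suc k) \<omega> = total_time D r k \<omega> + D r (Suc k) \<omega>"
  by (simp add: total_time_def)

text \<open>
  Regrouping the first \<open>m\<close> sojourns by direction. With \<open>g = 1\<close> this is the switching time, with \<open>g = dir\<close>
  the displacement per unit speed.
\<close>

lemma sum_upto_switch:
  fixes g :: "nat \<Rightarrow> 'v::real_vector"
  shows "(\<Sum>i<m. D (i mod 4 + 1) (i div 4 + 1) \<omega> *\<^sub>R g (i mod 4 + 1)) =
    (\<Sum>r = 1..4. total_time D r (completed_sojourns m r) \<omega> *\<^sub>R g r)"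
proof (induction m)
  case 0
  then show ?case by (simp add: completed_sojourns_def total_time_def)
next
  case (Suc m)
  have "total_time D r (completed_sojourns (Suc m) r) \<omega> *\<^sub>R g r =
      total_time D r (completed_sojourns m r) \<omega> *\<^sub>R g r +
      (if r = m mod 4 + 1 then D (m mod 4 + 1) (m div 4 + 1) \<omega> *\<^sub>R g (m mod 4 + 1) else 0)"
    if "r \<in> {1..4}" for r
    using completed_sojourns_Suc[OF that, of m] completed_sojourns_current[of m]
    by (auto simp: total_time_Suc scaleR_add_left)
  then have "(\<Sum>r = 1..4. total_time D r (completed_sojourns (Suc m) r) \<omega> *\<^sub>R g r) =
      (\<Sum>r = 1..4. total_time D r (completed_sojourns m r) \<omega> *\<^sub>R g r) +
      D (m mod 4 + 1) (m div 4 + 1) \<omega> *\<^sub>R g (m mod 4 + 1)"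
    using current_direction[of m] by (simp add: sum.distrib)
  with Suc show ?case by simp
qed

lemma switch_time_eq:
  "switch_time D m \<omega> = (\<Sum>r = 1..4. total_time D r (completed_sojourns m r) \<omega>)"
proof -
  have "m mod 4 < 4" by simp
  then have split: "{1..4} = {1..m mod 4} \<union> {m mod 4 + 1..4}" by auto
  show ?thesis
    unfolding split switch_time_def
    by (subst sum.union_disjoint) (auto simp: completed_sojourns_def)
qed

lemma switch_time_0: "switch_time D 0 \<omega> = 0"
  by (simp add: switch_time_def total_time_def)

lemma switch_time_Suc:
  "switch_time D (Suc m) \<omega> = switch_time D m \<omega> + D (m mod 4 + 1) (m div 4 + 1) \<omega>"
  using sum_upto_switch[where g = "\<lambda>_. 1 :: real" and m = "Suc m" and D = D and \<omega> = \<omega>]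
    sum_upto_switch[where g = "\<lambda>_. 1 :: real" and m = m and D = D and \<omega> = \<omega>]
  by (simp add: switch_time_eq)

text \<open>
  Everything about a single trajectory follows from the strict positivity of its interarrival times,
  which holds almost surely.
\<close>

locale positive_path =
  fixes D :: "nat \<Rightarrow> nat \<Rightarrow> 'w \<Rightarrow> real" and \<omega> :: 'w
  assumes interarrival_pos: "j \<in> {1..4} \<Longrightarrow> k \<ge> 1 \<Longrightarrow> D j k \<omega> > 0"
begin

lemma switch_time_strict_mono: "strict_mono (\<lambda>m. switch_time D m \<omega>)"
  unfolding strict_mono_Suc_iff switch_time_Suc
  using interarrival_pos[OF current_direction] by simp

lemma switch_time_mono: "m \<le> n \<Longrightarrow> switch_time D m \<omega> \<le> switch_time D n \<omega>"
  using strict_mono_mono[OF switch_time_strict_mono] by (rule monoD)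

lemma switch_time_nonneg: "0 \<le> switch_time D m \<omega>"
  using switch_time_mono[of 0 m] by (simp add: switch_time_0)

lemma num_switches_eqI:
  assumes "switch_time D m \<omega> \<le> s" "s < switch_time D (m + 1) \<omega>"
  shows "num_switches D s \<omega> = m"
  unfolding num_switches_def
proof (rule Least_equality)
  fix n assume "s < switch_time D (n + 1) \<omega>"
  with assms(1) have "switch_time D m \<omega> < switch_time D (n + 1) \<omega>" by simp
  then show "m \<le> n"
    using strict_mono_less[OF switch_time_strict_mono, of m "n + 1"] by simp
qed fact

lemma num_switches_bounds:
  assumes "0 \<le> s" "s < switch_time D n \<omega>"
  shows "switch_time D (num_switches D s \<omega>) \<omega> \<le> s"
    and "s < switch_time D (num_switches D s \<omega> + 1) \<omega>"
proof -
  let ?P = "\<lambda>m. s < switch_time D (m + 1) \<omega>"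
  have ex: "?P n" using assms(2) switch_time_mono[of n "n + 1"] by simp
  show "s < switch_time D (num_switches D s \<omega> + 1) \<omega>"
    unfolding num_switches_def by (rule LeastI[of ?P, OF ex])
  show "switch_time D (num_switches D s \<omega>) \<omega> \<le> s"
  proof (cases "num_switches D s \<omega>")
    case 0
    then show ?thesis using assms(1) by (simp add: switch_time_0)
  next
    case (Suc k)
    then have "\<not> ?P k"
      unfolding num_switches_def using not_less_Least[of k ?P] by simp
    then show ?thesis using Suc by simp
  qed
qed

lemma velocity_integral_upto_switch:
  "has_bochner_integral lborel (\<lambda>s. indicator {0..<switch_time D m \<omega>} s *\<^sub>R velocity D s \<omega>)
    (\<Sum>r = 1..4. total_time D r (completed_sojourns m r) \<omega> *\<^sub>R dir r)"
proof -
  have "has_bochner_integral lborel (\<lambda>s. indicator {0..<switch_time D m \<omega>} s *\<^sub>R velocity D s \<omega>)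
    (\<Sum>i<m. D (i mod 4 + 1) (i div 4 + 1) \<omega> *\<^sub>R dir (i mod 4 + 1))"
  proof (induction m)
    case 0
    then show ?case by (simp add: switch_time_0 has_bochner_integral_zero)
  next
    case (Suc m)
    let ?I = "{switch_time D m \<omega>..<switch_time D (Suc m) \<omega>}"
    have le: "switch_time D m \<omega> \<le> switch_time D (Suc m) \<omega>" by (rule switch_time_mono) simp
    have "has_bochner_integral lborel (\<lambda>s. indicator ?I s *\<^sub>R dir (m mod 4 + 1))
        (measure lborel ?I *\<^sub>R dir (m mod 4 + 1))"
      by (rule has_bochner_integral_indicator) (simp_all add: le)
    also have "measure lborel ?I = D (m mod 4 + 1) (m div 4 + 1) \<omega>"
      using le by (simp add: switch_time_Suc)
    finally have "has_bochner_integral lborel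
       (\<lambda>s. indicator {0..<switch_time D m \<omega>} s *\<^sub>R velocity D s \<omega> + indicator ?I s *\<^sub>R dir (m mod 4 + 1))
       (\<Sum>i<Suc m. D (i mod 4 + 1) (i div 4 + 1) \<omega> *\<^sub>R dir (i mod 4 + 1))"
      using Suc by (simp add: has_bochner_integral_add)
    moreover have "indicator {0..<switch_time D m \<omega>} s *\<^sub>R velocity D s \<omega> + indicator ?I s *\<^sub>R dir (m mod 4 + 1)
      = indicator {0..<switch_time D (Suc m) \<omega>} s *\<^sub>R velocity D s \<omega>" for s
      using num_switches_eqI[of m s] le switch_time_nonneg[of m]
      by (auto simp: velocity_def split: split_indicator)
    ultimately show ?case by simp
  qed
  then show ?thesis by (simp only: sum_upto_switch)
qed

text \<open>
  Between two switches, every direction except the current one \<open>j\<close> has accumulated complete sojourns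
  only, and the current one takes up the rest of the time \<open>t\<close>.
\<close>

lemma position_eq:
  fixes m :: nat and t :: real
  defines "y \<equiv> \<lambda>r. total_time D r (completed_sojourns m r) \<omega>" and "j \<equiv> m mod 4 + 1"
  assumes "switch_time D m \<omega> \<le> t" "t < switch_time D (m + 1) \<omega>"
  shows "position c D t \<omega> = point c (y(j := t - (\<Sum>r\<in>{1..4} - {j}. y r)))"
proof -
  have j: "j \<in> {1..4}" unfolding j_def by (rule current_direction)
  have "has_bochner_integral lborel (\<lambda>s. indicator {switch_time D m \<omega>..t} s *\<^sub>R dir j)
        (measure lborel {switch_time D m \<omega>..t} *\<^sub>R dir j)"
    by (rule has_bochner_integral_indicator) (simp_all add: assms)
  from has_bochner_integral_add[OF velocity_integral_upto_switch[of m] this]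
  have "has_bochner_integral lborel
      (\<lambda>s. indicator {0..<switch_time D m \<omega>} s *\<^sub>R velocity D s \<omega> + indicator {switch_time D m \<omega>..t} s *\<^sub>R dir j)
      ((\<Sum>r = 1..4. y r *\<^sub>R dir r) + (t - switch_time D m \<omega>) *\<^sub>R dir j)"
    using assms by simp
  also have "(\<lambda>s. indicator {0..<switch_time D m \<omega>} s *\<^sub>R velocity D s \<omega> + indicator {switch_time D m \<omega>..t} s *\<^sub>R dir j)
      = (\<lambda>s. indicator {0..t} s *\<^sub>R velocity D s \<omega>)"
  proof
    fix s
    show "indicator {0..<switch_time D m \<omega>} s *\<^sub>R velocity D s \<omega> + indicator {switch_time D m \<omega>..t} s *\<^sub>R dir j
      = indicator {0..t} s *\<^sub>R velocity D s \<omega>"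
      using num_switches_eqI[of m s] assms switch_time_nonneg[of m]
      by (auto simp: velocity_def split: split_indicator)
  qed
  finally have "position c D t \<omega> = c *\<^sub>R ((\<Sum>r = 1..4. y r *\<^sub>R dir r) + (t - switch_time D m \<omega>) *\<^sub>R dir j)"
    by (simp add: position_def set_lebesgue_integral_def has_bochner_integral_integral_eq)
  also have "switch_time D m \<omega> = y j + (\<Sum>r\<in>{1..4} - {j}. y r)"
    unfolding switch_time_eq y_def[symmetric] using j by (simp add: sum.remove)
  also have "(\<Sum>r = 1..4. y r *\<^sub>R dir r) = y j *\<^sub>R dir j + (\<Sum>r\<in>{1..4} - {j}. y r *\<^sub>R dir r)"
    using j by (simp add: sum.remove)
  also have "y j *\<^sub>R dir j + (\<Sum>r\<in>{1..4} - {j}. y r *\<^sub>R dir r) +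
        (t - (y j + (\<Sum>r\<in>{1..4} - {j}. y r))) *\<^sub>R dir j =
      (t - (\<Sum>r\<in>{1..4} - {j}. y r)) *\<^sub>R dir j + (\<Sum>r\<in>{1..4} - {j}. y r *\<^sub>R dir r)"
    by (simp add: algebra_simps)
  also have "\<dots> = (\<Sum>r = 1..4. (y(j := t - (\<Sum>r\<in>{1..4} - {j}. y r))) r *\<^sub>R dir r)"
    using j by (subst (2) sum.remove[of _ j]) (auto intro!: arg_cong2[where f = "(+)"] sum.cong)
  finally show ?thesis unfolding point_def .
qed

text \<open>
  Given the total times in the other directions, the number of switches is \<open>m\<close> exactly if the counting
  process of the current direction has reached \<open>m div 4\<close> at its own clock \<open>s\<close>. This separates the event
  into the three other waiting times and two consecutive waiting times of the current direction,
  which are independent.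
\<close>

lemma switch_time_bounds_iff:
  fixes m :: nat and t :: real
  defines "y \<equiv> \<lambda>r. total_time D r (completed_sojourns m r) \<omega>" and "j \<equiv> m mod 4 + 1"
  defines "s \<equiv> t - (\<Sum>r\<in>{1..4} - {j}. y r)"
  shows "switch_time D m \<omega> \<le> t \<and> t < switch_time D (m + 1) \<omega> \<longleftrightarrow>
    total_time D j (m div 4) \<omega> \<le> s \<and> s < total_time D j (m div 4 + 1) \<omega>"
proof -
  have j: "j \<in> {1..4}" unfolding j_def by (rule current_direction)
  have 1: "switch_time D m \<omega> = y j + (\<Sum>r\<in>{1..4} - {j}. y r)"
    unfolding switch_time_eq y_def[symmetric] using j by (simp add: sum.remove)
  have 2: "y j = total_time D j (m div 4) \<omega>"
    by (simp add: y_def j_def completed_sojourns_def)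
  show ?thesis
    unfolding Suc_eq_plus1[symmetric] switch_time_Suc total_time_Suc 1 s_def
    using 2 by (auto simp: j_def)
qed

end

section \<open>Joint law of the sojourn times\<close>

text \<open>
  Independent variables with densities have the product as joint density. The proof changes the
  densities outside \<open>I\<close> to an arbitrary probability density, so that the product construction applies
  to a family of probability spaces indexed by the whole type.
\<close>

lemma PiM_density_lborel:
  fixes f :: "'i \<Rightarrow> real \<Rightarrow> real"
  assumes I: "finite I"
    and f [measurable]: "\<And>i. i \<in> I \<Longrightarrow> f i \<in> borel_measurable borel"
    and prob: "\<And>i. i \<in> I \<Longrightarrow> prob_space (density lborel (f i))"
  shows "PiM I (\<lambda>i. density lborel (f i)) =
    density (PiM I (\<lambda>_. lborel)) (\<lambda>x. \<Prod>i\<in>I. ennreal (f i (x i)))"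
proof -
  define g where "g i = (if i \<in> I then f i else exponential_density 1)" for i
  have g [measurable]: "g i \<in> borel_measurable borel" for i
    using f[of i] by (cases "i \<in> I") (auto simp: g_def cong: measurable_cong)
  have pg: "prob_space (density lborel (g i))" for i
    using prob[of i] by (auto simp: g_def intro!: prob_space_exponential_density)
  interpret L: product_sigma_finite "\<lambda>_ :: 'i. lborel :: real measure" ..
  interpret N: product_prob_space "\<lambda>i. density lborel (g i)"
    by (intro product_prob_space.intro product_prob_space_axioms.intro product_sigma_finite.intro
        prob_space_imp_sigma_finite pg)
  have "PiM I (\<lambda>i. density lborel (g i)) =
    density (PiM I (\<lambda>_. lborel)) (\<lambda>x. \<Prod>i\<in>I. ennreal (g i (x i)))"
  proof (rule measure_eqI_PiM_finite[where I = I and M = "\<lambda>_. borel" and A = "\<lambda>_. space (PiM I (\<lambda>_. borel))"])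
    fix A :: "'i \<Rightarrow> real set" assume A: "\<And>i. i \<in> I \<Longrightarrow> A i \<in> sets borel"
    have PA: "Pi\<^sub>E I A \<in> sets (PiM I (\<lambda>_. lborel))" by (intro sets_PiM_I_finite I) (simp add: A)
    have "emeasure (density (PiM I (\<lambda>_. lborel)) (\<lambda>x. \<Prod>i\<in>I. ennreal (g i (x i)))) (Pi\<^sub>E I A) =
        (\<integral>\<^sup>+x. (\<Prod>i\<in>I. ennreal (g i (x i))) * indicator (Pi\<^sub>E I A) x \<partial>PiM I (\<lambda>_. lborel))"
      by (rule emeasure_density[OF _ PA]) measurable
    also have "\<dots> = (\<integral>\<^sup>+x. (\<Prod>i\<in>I. ennreal (g i (x i)) * indicator (A i) (x i)) \<partial>PiM I (\<lambda>_. lborel))"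
    proof (rule nn_integral_cong)
      fix x :: "'i \<Rightarrow> real" assume "x \<in> space (PiM I (\<lambda>_. lborel))"
      then have "indicator (Pi\<^sub>E I A) x = (\<Prod>i\<in>I. indicator (A i) (x i) :: ennreal)"
        using I by (auto simp: space_PiM PiE_iff indicator_def prod_zero_iff)
      then show "(\<Prod>i\<in>I. ennreal (g i (x i))) * indicator (Pi\<^sub>E I A) x =
          (\<Prod>i\<in>I. ennreal (g i (x i)) * indicator (A i) (x i))"
        by (simp add: prod.distrib)
    qed
    also have "\<dots> = (\<Prod>i\<in>I. \<integral>\<^sup>+x. ennreal (g i x) * indicator (A i) x \<partial>lborel)"
      using A by (intro L.product_nn_integral_prod[OF I]) auto
    also have "\<dots> = (\<Prod>i\<in>I. emeasure (density lborel (g i)) (A i))"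
      using A by (intro prod.cong) (auto simp: emeasure_density)
    also have "\<dots> = emeasure (PiM I (\<lambda>i. density lborel (g i))) (Pi\<^sub>E I A)"
      using A I by (subst N.emeasure_PiM) auto
    finally show "emeasure (PiM I (\<lambda>i. density lborel (g i))) (Pi\<^sub>E I A) =
      emeasure (density (PiM I (\<lambda>_. lborel)) (\<lambda>x. \<Prod>i\<in>I. ennreal (g i (x i)))) (Pi\<^sub>E I A)" ..
  next
    show "emeasure (PiM I (\<lambda>i. density lborel (g i))) (space (PiM I (\<lambda>_. borel))) \<noteq> \<infinity>"
      using finite_measure.emeasure_finite[OF prob_space.axioms(1)[OF prob_space_PiM[of I "\<lambda>i. density lborel (g i)"]]] pg
      by simp
    show "range (\<lambda>_. space (PiM I (\<lambda>_. borel :: real measure))) \<subseteq> prod_algebra I (\<lambda>_. borel)"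
      using I by (auto simp: space_PiM intro!: prod_algebraI_finite)
  qed (auto intro!: sets_PiM_cong I)
  moreover have "PiM I (\<lambda>i. density lborel (g i)) = PiM I (\<lambda>i. density lborel (f i))"
    by (intro PiM_cong) (auto simp: g_def)
  moreover have "(\<Prod>i\<in>I. ennreal (g i (x i))) = (\<Prod>i\<in>I. ennreal (f i (x i)))" for x
    by (intro prod.cong) (auto simp: g_def)
  ultimately show ?thesis by simp
qed

locale cyclic_motion = prob_space M
  for M :: "'w measure" +
  fixes lam :: "nat \<Rightarrow> real" and al :: "nat \<Rightarrow> 'w \<Rightarrow> real"
    and D :: "nat \<Rightarrow> nat \<Rightarrow> 'w \<Rightarrow> real" and c t :: real
  assumes c_pos: "c > 0" and t_pos: "t > 0"
    and lam_pos: "j \<in> {1..4} \<Longrightarrow> lam j > 0"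
    and gcp: "j \<in> {1..4} \<Longrightarrow> gcp_interarrivals M (lam j) (al j) (D j)"
    and indep: "indep_vars (\<lambda>_. PiM {1..} (\<lambda>_. borel)) (\<lambda>j \<omega>. \<lambda>k\<in>{1..}. D j k \<omega>) {1..4}"
begin

lemma D_measurable: "j \<in> {1..4} \<Longrightarrow> k \<ge> 1 \<Longrightarrow> D j k \<in> borel_measurable M"
  using gcp_interarrival_measurable[OF gcp] .

lemma total_time_measurable:
  "j \<in> {1..4} \<Longrightarrow> total_time D j k \<in> borel_measurable M"
  unfolding total_time_def by (intro borel_measurable_sum D_measurable) auto

lemma switch_time_measurable [measurable]: "switch_time D m \<in> borel_measurable M"
proof -
  have "switch_time D m = (\<lambda>\<omega>. \<Sum>r = 1..4. total_time D r (completed_sojourns m r) \<omega>)"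
    by (simp add: fun_eq_iff switch_time_eq)
  then show ?thesis
    by (simp only:) (intro borel_measurable_sum total_time_measurable)
qed

lemma num_switches_measurable [measurable (raw)]:
  assumes [measurable]: "f \<in> borel_measurable N" "g \<in> N \<rightarrow>\<^sub>M M"
  shows "(\<lambda>x. num_switches D (f x) (g x)) \<in> N \<rightarrow>\<^sub>M count_space UNIV"
  unfolding num_switches_def by measurable

lemma velocity_measurable [measurable (raw)]:
  assumes [measurable]: "f \<in> borel_measurable N" "g \<in> N \<rightarrow>\<^sub>M M"
  shows "(\<lambda>x. velocity D (f x) (g x)) \<in> borel_measurable N"
  unfolding velocity_def by measurable

lemma position_measurable [measurable]: "position c D s \<in> borel_measurable M"
  unfolding position_def[abs_def] set_lebesgue_integral_def by measurable

lemma AE_positive_path: "AE \<omega> in M. positive_path D \<omega>"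
proof -
  have "AE \<omega> in M. \<forall>j\<in>{1..4}. \<forall>k\<in>{1..}. D j k \<omega> > 0"
    using gcp_interarrival_pos[OF gcp lam_pos]
    by (intro AE_ball_countable[THEN iffD2] ballI) auto
  then show ?thesis by eventually_elim (auto intro!: positive_path.intro)
qed

text \<open>
  The switching times dominate the waiting times of the first direction, and the probability that the
  \<open>n\<close>-th of these is at most \<open>t\<close> decays geometrically in \<open>n\<close>.
\<close>

lemma AE_switch_time_exceeds: "AE \<omega> in M. \<exists>n. t < switch_time D n \<omega>"
proof -
  let ?q = "lam 1 * t / (1 + lam 1 * t)"
  have l: "lam 1 > 0" by (rule lam_pos) simp
  have [measurable]: "total_time D 1 k \<in> borel_measurable M" for k by (rule total_time_measurable) simp
  define N where "N = {\<omega> \<in> space M. \<forall>n. total_time D 1 n \<omega> \<le> t}"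
  have [measurable]: "N \<in> sets M" unfolding N_def by measurable
  have "prob N \<le> ?q ^ n" for n
  proof -
    have "{\<omega> \<in> space M. total_time D 1 n \<omega> \<le> t} \<in> events" by measurable
    then have "prob N \<le> prob {\<omega> \<in> space M. total_time D 1 n \<omega> \<le> t}"
      unfolding N_def by (rule finite_measure_mono[rotated]) auto
    also have "\<dots> = ?q ^ n"
      unfolding total_time_def using gcp_waiting_time_cdf[OF gcp l, of t n] t_pos by simp
    finally show ?thesis .
  qed
  moreover have "(\<lambda>n. ?q ^ n) \<longlonglongrightarrow> 0"
  proof (rule LIMSEQ_realpow_zero)
    have "1 + lam 1 * t > 0" using l t_pos by (simp add: add_pos_pos)
    then show "0 \<le> ?q" "?q < 1" using l t_pos by (simp_all add: field_simps)
  qed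
  ultimately have "prob N \<le> 0" by (intro LIMSEQ_le_const) auto
  then have "emeasure M N = 0" by (simp add: emeasure_eq_measure measure_le_0_iff)
  then have "AE \<omega> in M. \<omega> \<notin> N" by (intro AE_not_in) (auto simp: null_sets_def)
  with AE_positive_path AE_space show ?thesis
  proof eventually_elim
    case (elim \<omega>)
    then interpret positive_path D \<omega> by simp
    obtain n where n: "t < total_time D 1 n \<omega>"
      using elim by (auto simp: N_def not_le)
    \<comment> \<open>after 4 * n switches every direction has completed exactly n sojourns\<close>
    have "switch_time D (4 * n) \<omega> = (\<Sum>r = 1..4. total_time D r n \<omega>)"
      unfolding switch_time_eq by (intro sum.cong) (auto simp: completed_sojourns_def)
    also have "\<dots> \<ge> total_time D 1 n \<omega>"
    proof (rule member_le_sum)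
      fix r :: nat assume "r \<in> {1..4} - {1}"
      then show "0 \<le> total_time D r n \<omega>"
        unfolding total_time_def using interarrival_pos by (intro sum_nonneg less_imp_le) auto
    qed auto
    finally show ?case using n by (intro exI[of _ "4 * n"]) simp
  qed
qed

text \<open>
  Independence of the directions splits the law into the density of the finished total times \<open>U\<close> of the
  other directions and the law of the two consecutive waiting times \<open>V\<close> of the current direction.
\<close>

lemma sojourn_law:
  fixes m :: nat
  defines "j \<equiv> m mod 4 + 1"
  defines "A \<equiv> {1..4} - {j}"
  defines "U \<equiv> \<lambda>\<omega>. \<lambda>r\<in>A. total_time D r (completed_sojourns m r) \<omega>"
    and "V \<equiv> \<lambda>\<omega>. (total_time D j (m div 4) \<omega>, total_time D j (m div 4 + 1) \<omega>)"
  assumes k: "\<And>r. r \<in> A \<Longrightarrow> completed_sojourns m r \<ge> 1"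
    and S [measurable]: "S \<in> sets (PiM A (\<lambda>_. borel) \<Otimes>\<^sub>M (borel \<Otimes>\<^sub>M borel))"
  shows "emeasure M {\<omega> \<in> space M. (U \<omega>, V \<omega>) \<in> S} =
    (\<integral>\<^sup>+u. (\<Prod>r\<in>A. ennreal (gcp_density (lam r) (completed_sojourns m r) (u r))) *
      emeasure M {\<omega> \<in> space M. (u, V \<omega>) \<in> S} \<partial>PiM A (\<lambda>_. lborel))"
proof -
  have j: "j \<in> {1..4}" unfolding j_def by (rule current_direction)
  have A: "A \<subseteq> {1..4}" "finite A" "{j} \<subseteq> {1..4}" "A \<inter> {j} = {}" using j by (auto simp: A_def)
  have A_ne: "A \<noteq> {}"
  proof -
    have "1 \<in> A \<or> 2 \<in> A" by (auto simp: A_def)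
    then show ?thesis by auto
  qed
  \<comment> \<open>a common value type for all directions, as needed to speak of an independent family\<close>
  define Z where "Z r \<omega> = (total_time D r (completed_sojourns m r) \<omega>, total_time D r (completed_sojourns m r + 1) \<omega>)"
    for r \<omega>
  have indep_Z: "indep_vars (\<lambda>_. borel \<Otimes>\<^sub>M borel) Z {1..4}"
  proof -
    define f where "f r x = (\<Sum>i = 1..completed_sojourns m r. x i, \<Sum>i = 1..completed_sojourns m r + 1. x i)"
      for r and x :: "nat \<Rightarrow> real"
    have "f r \<in> PiM {1..} (\<lambda>_. borel) \<rightarrow>\<^sub>M borel \<Otimes>\<^sub>M borel" for r
      unfolding f_def by measurable
    from indep_vars_compose2[OF indep this]
    have "indep_vars (\<lambda>_. borel \<Otimes>\<^sub>M borel) (\<lambda>r \<omega>. f r (\<lambda>k\<in>{1..}. D r k \<omega>)) {1..4}" .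
    also have "(\<lambda>r \<omega>. f r (\<lambda>k\<in>{1..}. D r k \<omega>)) = Z"
      by (simp add: fun_eq_iff f_def Z_def total_time_def)
    finally show ?thesis .
  qed
  let ?bb = "borel \<Otimes>\<^sub>M borel :: (real \<times> real) measure"
  let ?ZA = "\<lambda>\<omega>. \<lambda>r\<in>A. Z r \<omega>" and ?Zj = "\<lambda>\<omega>. \<lambda>r\<in>{j}. Z r \<omega>"
  have Z: "indep_var (PiM A (\<lambda>_. ?bb)) ?ZA (PiM {j} (\<lambda>_. ?bb)) ?Zj"
    by (rule indep_var_restrict[OF indep_Z A(4,1,3)])
  then have ZA [measurable]: "?ZA \<in> M \<rightarrow>\<^sub>M PiM A (\<lambda>_. ?bb)"
    and Zj [measurable]: "?Zj \<in> M \<rightarrow>\<^sub>M PiM {j} (\<lambda>_. ?bb)"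
    by (auto dest: indep_var_rv1 indep_var_rv2)
  have U_Z: "U \<omega> = (\<lambda>r\<in>A. fst (?ZA \<omega> r))" and V_Z: "V \<omega> = ?Zj \<omega> j" for \<omega>
    by (auto simp: U_def V_def Z_def j_def completed_sojourns_def)
  have U [measurable]: "U \<in> M \<rightarrow>\<^sub>M PiM A (\<lambda>_. borel)" and V [measurable]: "V \<in> M \<rightarrow>\<^sub>M ?bb"
    unfolding U_def V_def using A j total_time_measurable by (auto intro!: measurable_restrict measurable_Pair)
  have dU: "distr M (PiM A (\<lambda>_. borel)) U = density (PiM A (\<lambda>_. lborel))
      (\<lambda>u. \<Prod>r\<in>A. ennreal (gcp_density (lam r) (completed_sojourns m r) (u r)))"
  proof -
    have d: "distributed M lborel (total_time D r (completed_sojourns m r))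
        (gcp_density (lam r) (completed_sojourns m r))" if "r \<in> A" for r
    proof -
      have "r \<in> {1..4}" using that A by auto
      from gcp_waiting_time_distributed[OF gcp[OF this] lam_pos[OF this] k[OF that]]
      show ?thesis by (simp add: total_time_def[abs_def])
    qed
    have "indep_vars (\<lambda>_. borel) (\<lambda>r. total_time D r (completed_sojourns m r)) A"
      using indep_vars_compose2[OF indep_vars_subset[OF indep_Z A(1)], of "\<lambda>_. fst" "\<lambda>_. borel"]
      by (simp add: Z_def)
    then have "distr M (PiM A (\<lambda>_. borel)) U =
        PiM A (\<lambda>r. distr M borel (total_time D r (completed_sojourns m r)))"
      unfolding U_def using A A_ne
      by (subst (asm) indep_vars_iff_distr_eq_PiM') (auto intro!: total_time_measurable)
    also have "\<dots> = PiM A (\<lambda>r. density lborel (gcp_density (lam r) (completed_sojourns m r)))"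
    proof (rule PiM_cong)
      fix r assume "r \<in> A"
      show "distr M borel (total_time D r (completed_sojourns m r)) =
          density lborel (gcp_density (lam r) (completed_sojourns m r))"
        using distributed_distr_eq_density[OF d[OF \<open>r \<in> A\<close>]] by (simp cong: distr_cong)
    qed simp
    also have "\<dots> = density (PiM A (\<lambda>_. lborel))
      (\<lambda>u. \<Prod>r\<in>A. ennreal (gcp_density (lam r) (completed_sojourns m r) (u r)))"
    proof (rule PiM_density_lborel[OF A(2)])
      fix r assume "r \<in> A"
      show "prob_space (density lborel (gcp_density (lam r) (completed_sojourns m r)))"
        unfolding distributed_distr_eq_density[OF d[OF \<open>r \<in> A\<close>], symmetric]
        by (rule prob_space_distr[OF distributed_measurable[OF d[OF \<open>r \<in> A\<close>]]])
    qed measurable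
    finally show ?thesis .
  qed
  interpret dV: prob_space "distr M (borel \<Otimes>\<^sub>M borel) V" by (rule prob_space_distr) measurable
  have sets_A [measurable_cong]: "sets (PiM A (\<lambda>_. lborel :: real measure)) = sets (PiM A (\<lambda>_. borel))"
    by (intro sets_PiM_cong) auto
  define F where "F u = emeasure M {\<omega> \<in> space M. (u, V \<omega>) \<in> S}" for u
  have F_eq: "F u = emeasure (distr M ?bb V) (Pair u -` S)" for u
    unfolding F_def by (subst emeasure_distr) (auto intro!: arg_cong2[where f = emeasure] sets_Pair1)
  have F [measurable]: "F \<in> borel_measurable (PiM A (\<lambda>_. borel))"
    unfolding F_eq using dV.measurable_emeasure_Pair[of S "PiM A (\<lambda>_. borel)"] by simp
  let ?S = "{p \<in> space (PiM A (\<lambda>_. ?bb) \<Otimes>\<^sub>M PiM {j} (\<lambda>_. ?bb)). (\<lambda>r\<in>A. fst (fst p r), snd p j) \<in> S}"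
  have S' [measurable]: "?S \<in> sets (PiM A (\<lambda>_. ?bb) \<Otimes>\<^sub>M PiM {j} (\<lambda>_. ?bb))" by measurable
  interpret dZ: prob_space "distr M (PiM {j} (\<lambda>_. ?bb)) ?Zj" by (rule prob_space_distr) measurable
  have "emeasure M {\<omega> \<in> space M. (U \<omega>, V \<omega>) \<in> S} =
      emeasure (distr M (PiM A (\<lambda>_. ?bb) \<Otimes>\<^sub>M PiM {j} (\<lambda>_. ?bb)) (\<lambda>\<omega>. (?ZA \<omega>, ?Zj \<omega>))) ?S"
    unfolding U_Z V_Z
    by (subst emeasure_distr)
      (auto simp: measurable_space[OF ZA] measurable_space[OF Zj] space_pair_measure
        intro!: arg_cong2[where f = emeasure])
  also have "\<dots> = emeasure (distr M (PiM A (\<lambda>_. ?bb)) ?ZA \<Otimes>\<^sub>M distr M (PiM {j} (\<lambda>_. ?bb)) ?Zj) ?S"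
    using Z[unfolded indep_var_distribution_eq] by simp
  also have "\<dots> = (\<integral>\<^sup>+z. emeasure (distr M (PiM {j} (\<lambda>_. ?bb)) ?Zj) (Pair z -` ?S) \<partial>distr M (PiM A (\<lambda>_. ?bb)) ?ZA)"
    by (rule dZ.emeasure_pair_measure_alt) simp
  also have "\<dots> = (\<integral>\<^sup>+\<omega>. emeasure (distr M (PiM {j} (\<lambda>_. ?bb)) ?Zj) (Pair (?ZA \<omega>) -` ?S) \<partial>M)"
    by (rule nn_integral_distr[OF ZA], rule dZ.measurable_emeasure_Pair) simp
  also have "\<dots> = (\<integral>\<^sup>+\<omega>. F (U \<omega>) \<partial>M)"
  proof (rule nn_integral_cong)
    fix \<omega> assume \<omega>: "\<omega> \<in> space M"
    have "Pair (?ZA \<omega>) -` ?S \<in> sets (PiM {j} (\<lambda>_. ?bb))" by (rule sets_Pair1[OF S'])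
    then show "emeasure (distr M (PiM {j} (\<lambda>_. ?bb)) ?Zj) (Pair (?ZA \<omega>) -` ?S) = F (U \<omega>)"
      unfolding F_def U_Z V_Z
      by (subst emeasure_distr)
        (use \<omega> in \<open>auto simp: measurable_space[OF ZA] measurable_space[OF Zj] space_pair_measure
          intro!: arg_cong2[where f = emeasure]\<close>)
  qed
  also have "\<dots> = (\<integral>\<^sup>+u. F u \<partial>distr M (PiM A (\<lambda>_. borel)) U)"
    by (rule nn_integral_distr[symmetric, OF U]) (simp add: F)
  also have "\<dots> = (\<integral>\<^sup>+u. (\<Prod>r\<in>A. ennreal (gcp_density (lam r) (completed_sojourns m r) (u r))) *
      emeasure M {\<omega> \<in> space M. (u, V \<omega>) \<in> S} \<partial>PiM A (\<lambda>_. lborel))"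
    unfolding dU F_def[symmetric] by (subst nn_integral_density) measurable
  finally show ?thesis .
qed

end

text \<open>
  The coordinate \<open>tau\<close> picks out the direction: it maps \<open>dir i\<close>, the position after unit time spent in
  direction \<open>i\<close> alone at unit speed, to the \<open>i\<close>-th unit vector.
\<close>

lemma dir_inj:
  assumes "i \<in> {1..4}" "j \<in> {1..4}" "dir i = dir j"
  shows "i = j"
proof -
  have tau_dir: "tau 1 1 (dir i) r = (if r = i then 1 else 0)" if "i \<in> {1..4}" "r \<in> {1..4}" for i r
  proof -
    have "point 1 (\<lambda>r. if r = i then 1 else 0) = dir i"
      using that(1) by (simp add: point_def if_distrib[of "\<lambda>u. u *\<^sub>R _"] cong: if_cong)
    with tau_point[of 1 r "\<lambda>r. if r = i then 1 else 0" 1] show ?thesis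
      using that by simp
  qed
  show ?thesis
    using tau_dir[OF assms(1,1)] tau_dir[OF assms(2,1)] assms(3) by (simp split: if_splits)
qed

text \<open>
  The density of the sojourn times after exactly \<open>m\<close> switches: the waiting time densities of the
  other directions times the probability that the current direction has finished \<open>m div 4\<close> sojourns.
\<close>

definition state_density :: "(nat \<Rightarrow> real) \<Rightarrow> nat \<Rightarrow> (nat \<Rightarrow> real) \<Rightarrow> real" where
  "state_density l m y = (let j = m mod 4 + 1; q = m div 4 in
     (\<Prod>r\<in>{1..4} - {j}. gcp_density (l r) (completed_sojourns m r) (y r)) *
     ((l j * y j) ^ q / (1 + l j * y j) ^ (q + 1)))"

lemma state_density_cong:
  assumes "\<And>r. r \<in> {1..4} \<Longrightarrow> y r = y' r"
  shows "state_density l m y = state_density l m y'"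
proof -
  have "y (m mod 4 + 1) = y' (m mod 4 + 1)" by (rule assms[OF current_direction])
  moreover have "(\<Prod>r\<in>{1..4} - {m mod 4 + 1}. gcp_density (l r) (completed_sojourns m r) (y r)) =
      (\<Prod>r\<in>{1..4} - {m mod 4 + 1}. gcp_density (l r) (completed_sojourns m r) (y' r))"
    using assms by (intro prod.cong) auto
  ultimately show ?thesis by (simp add: state_density_def)
qed

lemma point_cong:
  assumes "\<And>r. r \<in> {1..4} \<Longrightarrow> y r = y' r"
  shows "point c y = point c y'"
  unfolding point_def using assms by (intro arg_cong2[where f = scaleR] sum.cong) auto

lemma state_density_nonneg:
  assumes "\<And>r. r \<in> {1..4} \<Longrightarrow> l r > 0" "\<And>r. r \<in> {1..4} \<Longrightarrow> y r > 0"
  shows "state_density l m y \<ge> 0"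
proof -
  have "0 \<le> (\<Prod>r\<in>{1..4} - {m mod 4 + 1}. gcp_density (l r) (completed_sojourns m r) (y r))"
    using assms(1) by (intro prod_nonneg gcp_density_nonneg) auto
  moreover have "0 < l (m mod 4 + 1)" "0 < y (m mod 4 + 1)"
    using assms current_direction by blast+
  then have "0 \<le> (l (m mod 4 + 1) * y (m mod 4 + 1)) ^ (m div 4) /
      (1 + l (m mod 4 + 1) * y (m mod 4 + 1)) ^ (m div 4 + 1)"
    by (intro divide_nonneg_nonneg zero_le_power add_nonneg_nonneg mult_nonneg_nonneg) simp_all
  ultimately show ?thesis
    unfolding state_density_def Let_def by (rule mult_nonneg_nonneg)
qed

context cyclic_motion
begin

text \<open>
  The density of the position on the event of exactly \<open>m\<close> switches. The path description turns the event
  into one about independent waiting times, the coordinate of the current direction is traded for the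
  fourth one, and the resulting integral is a change of variables away from the claim.
\<close>

lemma state_probability:
  assumes [measurable]: "B \<in> sets borel" and sub: "B \<subseteq> tetrahedron c t"
  shows "emeasure M {\<omega> \<in> space M. position c D t \<omega> \<in> B \<and> num_switches D t \<omega> = m} =
    (\<integral>\<^sup>+x. ennreal (state_density lam m (tau c t x) / det (dir_matrix c)) * indicator B x \<partial>lborel)"
proof -
  define j where "j = m mod 4 + 1"
  define q where "q = m div 4"
  define A where "A = {1..4} - {j}"
  define k where "k = completed_sojourns m"
  \<comment> \<open>U: total times in the other directions; V: the waiting times that enclose the time spent in direction j\<close>
  define U where "U \<omega> = (\<lambda>r\<in>A. total_time D r (k r) \<omega>)" for \<omega>
  define V where "V \<omega> = (total_time D j q \<omega>, total_time D j (q + 1) \<omega>)" for \<omega>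
  \<comment> \<open>full: the four sojourn times recovered from the finished ones and the total time t\<close>
  define full where "full u = u(j := t - (\<Sum>r\<in>A. u r))" for u :: "nat \<Rightarrow> real"
  have j: "j \<in> {1..4}" unfolding j_def by (rule current_direction)
  have [simp]: "finite A" "j \<notin> A" by (auto simp: A_def)
  have insert_A: "{1..4} = insert j A" using j by (auto simp: A_def)
  have full_sum: "(\<Sum>r = 1..4. full u r) = t" for u
  proof -
    have "(\<Sum>r\<in>A. full u r) = (\<Sum>r\<in>A. u r)"
      using \<open>j \<notin> A\<close> by (intro sum.cong) (auto simp: full_def)
    then show ?thesis unfolding insert_A by (simp add: full_def)
  qed
  have full_pos: "full u r > 0" if "point c (full u) \<in> B" "r \<in> {1..4}" for u r
    using tau_point[OF c_pos that(2) full_sum[of u]] tau_pos[OF c_pos _ that(2)] that(1) sub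
    by fastforce
  have path: "AE \<omega> in M. position c D t \<omega> \<in> B \<and> num_switches D t \<omega> = m \<longleftrightarrow>
     point c (full (U \<omega>)) \<in> B \<and> fst (V \<omega>) \<le> full (U \<omega>) j \<and> full (U \<omega>) j < snd (V \<omega>)"
    using AE_positive_path AE_switch_time_exceeds
  proof eventually_elim
    case (elim \<omega>)
    then interpret positive_path D \<omega> by simp
    obtain n where n: "t < switch_time D n \<omega>" using elim by auto
    have num: "num_switches D t \<omega> = m \<longleftrightarrow> switch_time D m \<omega> \<le> t \<and> t < switch_time D (m + 1) \<omega>"
      using num_switches_bounds[OF _ n] t_pos num_switches_eqI[of m t] by auto
    have s: "(\<Sum>r\<in>A. U \<omega> r) = (\<Sum>r\<in>{1..4} - {j}. total_time D r (completed_sojourns m r) \<omega>)"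
      by (auto simp: U_def k_def A_def intro!: sum.cong)
    have fj: "full (U \<omega>) j = t - (\<Sum>r\<in>{1..4} - {j}. total_time D r (completed_sojourns m r) \<omega>)"
      by (simp add: full_def s)
    have "point c (full (U \<omega>)) = point c ((\<lambda>r. total_time D r (completed_sojourns m r) \<omega>)
        (j := t - (\<Sum>r\<in>{1..4} - {j}. total_time D r (completed_sojourns m r) \<omega>)))"
      by (rule point_cong) (auto simp: full_def s U_def k_def A_def)
    then show ?case
      unfolding num fj V_def fst_conv snd_conv
      using switch_time_bounds_iff[of m t] position_eq[of m t c]
      unfolding j_def[symmetric] q_def[symmetric] by auto
  qed
  have [measurable]: "(\<lambda>u. point c (full u)) \<in> borel_measurable (PiM A (\<lambda>_. borel))"
  proof -
    have "(\<lambda>u. full u r) \<in> borel_measurable (PiM A (\<lambda>_. borel))" if "r \<in> {1..4}" for r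
      using that unfolding insert_A full_def by (cases "r = j") auto
    then show ?thesis unfolding point_def by measurable
  qed
  have [measurable]: "(\<lambda>u. full u j) \<in> borel_measurable (PiM A (\<lambda>_. borel))"
    unfolding full_def by simp
  let ?bb = "borel \<Otimes>\<^sub>M borel :: (real \<times> real) measure"
  define S where "S = {p \<in> space (PiM A (\<lambda>_. borel) \<Otimes>\<^sub>M ?bb). point c (full (fst p)) \<in> B \<and>
      fst (snd p) \<le> full (fst p) j \<and> full (fst p) j < snd (snd p)}"
  have S: "S \<in> sets (PiM A (\<lambda>_. borel) \<Otimes>\<^sub>M ?bb)" unfolding S_def by measurable
  have [measurable]: "total_time D r i \<in> borel_measurable M" if "r \<in> {1..4}" for r i
    using that by (rule total_time_measurable)
  have U [measurable]: "U \<in> M \<rightarrow>\<^sub>M PiM A (\<lambda>_. borel)" and V [measurable]: "V \<in> M \<rightarrow>\<^sub>M ?bb"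
    unfolding U_def[abs_def] V_def[abs_def] using j by (auto intro!: measurable_restrict measurable_Pair simp: A_def)
  have event: "emeasure M {\<omega> \<in> space M. position c D t \<omega> \<in> B \<and> num_switches D t \<omega> = m} =
      emeasure M {\<omega> \<in> space M. (U \<omega>, V \<omega>) \<in> S}"
  proof (rule emeasure_eq_AE)
    show "AE \<omega> in M. \<omega> \<in> {\<omega> \<in> space M. position c D t \<omega> \<in> B \<and> num_switches D t \<omega> = m} \<longleftrightarrow>
        \<omega> \<in> {\<omega> \<in> space M. (U \<omega>, V \<omega>) \<in> S}"
      using path AE_space
      by eventually_elim (auto simp: S_def space_pair_measure measurable_space[OF U])
    show "{\<omega> \<in> space M. (U \<omega>, V \<omega>) \<in> S} \<in> sets M"
      using S by measurable
  qed measurable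
  show ?thesis
  \<comment> \<open>a direction that has not been taken yet has sojourn time 0, which the open tetrahedron excludes\<close>
  proof (cases "\<exists>r\<in>A. k r = 0")
    case True
    then obtain r where r: "r \<in> A" "k r = 0" by auto
    then have r4: "r \<in> {1..4}" "r \<noteq> j" by (auto simp: A_def)
    have "state_density lam m y = 0" for y
    proof -
      have "(\<Prod>r\<in>A. gcp_density (lam r) (k r) (y r)) = 0"
        by (rule prod_zero) (use r in \<open>auto simp: gcp_density_def\<close>)
      then show ?thesis unfolding state_density_def Let_def j_def[symmetric] A_def[symmetric] k_def[symmetric] by simp
    qed
    moreover have "emeasure M {\<omega> \<in> space M. (U \<omega>, V \<omega>) \<in> S} = 0"
    proof -
      have "full (U \<omega>) r = 0" for \<omega>
        using r r4 by (simp add: full_def U_def total_time_def)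
      then have "{\<omega> \<in> space M. (U \<omega>, V \<omega>) \<in> S} = {}"
        using full_pos[OF _ r4(1)] by (fastforce simp: S_def)
      then show ?thesis by (simp only: emeasure_empty)
    qed
    ultimately show ?thesis unfolding event by simp
  next
    case False
    \<comment> \<open>as a function of all four times, the integrand allows another coordinate to be eliminated\<close>
    define H where "H y = indicator B (point c y) * ennreal (state_density lam m y)" for y
    have H [measurable]: "H \<in> borel_measurable (PiM {1..4} (\<lambda>_. borel))"
    proof -
      have [measurable]: "(\<lambda>y. point c y) \<in> borel_measurable (PiM {1..4} (\<lambda>_. borel))"
        unfolding point_def by measurable
      have "(\<lambda>y :: nat \<Rightarrow> real. y j) \<in> borel_measurable (PiM {1..4} (\<lambda>_. borel))"
        using j by (rule measurable_component_singleton)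
      then have [measurable]: "state_density lam m \<in> borel_measurable (PiM {1..4} (\<lambda>_. borel))"
        unfolding state_density_def[abs_def] Let_def j_def[symmetric] by measurable
      show ?thesis unfolding H_def by measurable
    qed
    have "emeasure M {\<omega> \<in> space M. (U \<omega>, V \<omega>) \<in> S} =
      (\<integral>\<^sup>+u. (\<Prod>r\<in>A. ennreal (gcp_density (lam r) (k r) (u r))) *
        emeasure M {\<omega> \<in> space M. (u, V \<omega>) \<in> S} \<partial>PiM A (\<lambda>_. lborel))"
      unfolding U_def V_def A_def j_def q_def k_def
      by (rule sojourn_law) (use False S in \<open>auto simp: A_def j_def k_def Suc_le_eq\<close>)
    also have "\<dots> = (\<integral>\<^sup>+u. H (full u) \<partial>PiM A (\<lambda>_. lborel))"
    proof (rule nn_integral_cong)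
      fix u :: "nat \<Rightarrow> real" assume "u \<in> space (PiM A (\<lambda>_. lborel))"
      then have u: "u \<in> space (PiM A (\<lambda>_. borel))" by (simp add: space_PiM)
      show "(\<Prod>r\<in>A. ennreal (gcp_density (lam r) (k r) (u r))) *
          emeasure M {\<omega> \<in> space M. (u, V \<omega>) \<in> S} = H (full u)"
      proof (cases "point c (full u) \<in> B")
        case B: True
        have s: "full u j > 0" by (rule full_pos[OF B j])
        have "{\<omega> \<in> space M. (u, V \<omega>) \<in> S} = {\<omega> \<in> space M. (\<Sum>i = 1..q. D j i \<omega>) \<le> full u j \<and>
            full u j < (\<Sum>i = 1..q + 1. D j i \<omega>)}"
          using u B by (auto simp: S_def V_def space_pair_measure total_time_def)
        then have "emeasure M {\<omega> \<in> space M. (u, V \<omega>) \<in> S} =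
            ennreal ((lam j * full u j) ^ q / (1 + lam j * full u j) ^ (q + 1))"
          using gcp_count_probability[OF gcp[OF j] lam_pos[OF j], of "full u j" q] s
          by (simp add: emeasure_eq_measure)
        moreover have "(\<Prod>r\<in>A. ennreal (gcp_density (lam r) (k r) (u r))) =
            ennreal (\<Prod>r\<in>A. gcp_density (lam r) (k r) (full u r))"
          using lam_pos unfolding insert_A
          by (subst prod_ennreal) (auto simp: full_def gcp_density_nonneg intro!: arg_cong[where f = ennreal] prod.cong)
        moreover have "0 \<le> (\<Prod>r\<in>A. gcp_density (lam r) (k r) (full u r))"
          using lam_pos unfolding insert_A by (intro prod_nonneg gcp_density_nonneg) auto
        ultimately show ?thesis
          using B unfolding H_def state_density_def Let_def j_def[symmetric] A_def[symmetric] k_def[symmetric] q_def[symmetric]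
          by (simp flip: ennreal_mult')
      next
        case B: False
        then have "{\<omega> \<in> space M. (u, V \<omega>) \<in> S} = {}" by (auto simp: S_def)
        then have "emeasure M {\<omega> \<in> space M. (u, V \<omega>) \<in> S} = 0" by (simp only: emeasure_empty)
        with B show ?thesis by (simp add: H_def)
      qed
    qed
    also have "\<dots> = (\<integral>\<^sup>+y. H (y(4 := t - (\<Sum>r\<in>{1..4} - {4}. y r))) \<partial>PiM ({1..4} - {4}) (\<lambda>_. lborel))"
      unfolding full_def A_def by (rule nn_integral_PiM_exchange) (use j H in auto)
    also have "\<dots> = (\<integral>\<^sup>+y. (\<lambda>x. indicator B x * ennreal (state_density lam m (tau c t x)))
        (point c (y(4 := t - (\<Sum>r\<in>{1..4} - {4}. y r)))) \<partial>PiM ({1..4} - {4}) (\<lambda>_. lborel))"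
    proof (rule nn_integral_cong)
      fix y :: "nat \<Rightarrow> real"
      let ?y = "y(4 := t - (\<Sum>r\<in>{1..4} - {4}. y r))"
      have "(\<Sum>r = 1..4. ?y r) = t"
        by (subst sum.remove[of _ 4]) (auto intro!: sum.cong)
      then have "state_density lam m (tau c t (point c ?y)) = state_density lam m ?y"
        by (intro state_density_cong tau_point c_pos)
      then show "H ?y = (\<lambda>x. indicator B x * ennreal (state_density lam m (tau c t x))) (point c ?y)"
        by (simp add: H_def)
    qed
    finally have e: "emeasure M {\<omega> \<in> space M. (U \<omega>, V \<omega>) \<in> S} = \<dots>" .
    have det: "det (dir_matrix c) > 0" using c_pos by (simp add: det_dir_matrix)
    have [measurable]: "(\<lambda>x. state_density lam m (tau c t x)) \<in> borel_measurable borel"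
      unfolding state_density_def Let_def by measurable
    have "(\<integral>\<^sup>+x. indicator B x * ennreal (state_density lam m (tau c t x)) \<partial>lborel) =
        ennreal (det (dir_matrix c)) * emeasure M {\<omega> \<in> space M. (U \<omega>, V \<omega>) \<in> S}"
      unfolding e det_dir_matrix by (rule point_integral_substitution) (use c_pos in auto)
    then have "ennreal (1 / det (dir_matrix c)) * (\<integral>\<^sup>+x. indicator B x * ennreal (state_density lam m (tau c t x)) \<partial>lborel) =
        (ennreal (1 / det (dir_matrix c)) * ennreal (det (dir_matrix c))) * emeasure M {\<omega> \<in> space M. (U \<omega>, V \<omega>) \<in> S}"
      by (simp add: mult.assoc)
    also have "ennreal (1 / det (dir_matrix c)) * ennreal (det (dir_matrix c)) = 1"
      using det by (simp flip: ennreal_mult)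
    finally have "emeasure M {\<omega> \<in> space M. (U \<omega>, V \<omega>) \<in> S} =
       (\<integral>\<^sup>+x. ennreal (1 / det (dir_matrix c)) * (indicator B x * ennreal (state_density lam m (tau c t x))) \<partial>lborel)"
      by (subst nn_integral_cmult) auto
    also have "\<dots> = (\<integral>\<^sup>+x. ennreal (state_density lam m (tau c t x) / det (dir_matrix c)) * indicator B x \<partial>lborel)"
      using det by (intro nn_integral_cong) (auto split: split_indicator simp flip: ennreal_mult')
    finally show ?thesis unfolding event .
  qed
qed

text \<open>
  The particle has direction \<open>j\<close> exactly if the number of switches is \<open>j - 1\<close> modulo 4, and monotone
  convergence sums the densities of these disjoint events. Almost surely the motion starts at the
  origin in the first direction, so the conditioning has no effect.
\<close>

lemma state_density_series_is_motion_density: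
  assumes j: "j \<in> {1..4}" and [measurable]: "p \<in> borel_measurable borel"
    and sums: "\<And>x. x \<in> tetrahedron c t \<Longrightarrow>
      (\<lambda>q. state_density lam (4 * q + (j - 1)) (tau c t x) / det (dir_matrix c)) sums p x"
  shows "is_motion_density M c D t j p"
  unfolding is_motion_density_def
proof (intro ballI impI)
  fix B assume B [measurable]: "B \<in> sets borel" and "B \<subseteq> interior (tetrahedron c t)"
  then have sub: "B \<subseteq> tetrahedron c t" using interior_subset by blast
  have det: "det (dir_matrix c) > 0" using c_pos by (simp add: det_dir_matrix)
  define g where "g q x = state_density lam (4 * q + (j - 1)) (tau c t x) / det (dir_matrix c)" for q x
  have g_nonneg: "g q x \<ge> 0" if "x \<in> B" for q x
    unfolding g_def using that sub det
    by (intro divide_nonneg_pos state_density_nonneg lam_pos tau_pos c_pos) auto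
  have p_nonneg: "p x \<ge> 0" if "x \<in> B" for x
  proof -
    have s: "(\<lambda>q. g q x) sums p x" using sums that sub unfolding g_def by auto
    show ?thesis
      unfolding sums_unique[OF s] using sums_summable[OF s] g_nonneg[OF that] by (rule suminf_nonneg)
  qed
  have [measurable]: "g q \<in> borel_measurable borel" for q
    unfolding g_def state_density_def Let_def by measurable
  let ?E = "{\<omega> \<in> space M. position c D t \<omega> \<in> B \<and> velocity D t \<omega> = dir j}"
  let ?F = "\<lambda>q. {\<omega> \<in> space M. position c D t \<omega> \<in> B \<and> num_switches D t \<omega> = 4 * q + (j - 1)}"
  have "velocity D t \<omega> = dir j \<longleftrightarrow> (\<exists>q. num_switches D t \<omega> = 4 * q + (j - 1))" for \<omega>
  proof -
    have "velocity D t \<omega> = dir j \<longleftrightarrow> num_switches D t \<omega> mod 4 + 1 = j"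
      unfolding velocity_def using dir_inj[OF current_direction j] by auto
    also have "\<dots> \<longleftrightarrow> (\<exists>q. num_switches D t \<omega> = 4 * q + (j - 1))"
    proof
      assume "num_switches D t \<omega> mod 4 + 1 = j"
      then have "num_switches D t \<omega> = 4 * (num_switches D t \<omega> div 4) + (j - 1)" by auto
      then show "\<exists>q. num_switches D t \<omega> = 4 * q + (j - 1)" ..
    next
      assume "\<exists>q. num_switches D t \<omega> = 4 * q + (j - 1)"
      then obtain q where q: "num_switches D t \<omega> = 4 * q + (j - 1)" ..
      show "num_switches D t \<omega> mod 4 + 1 = j"
        unfolding q using j by (cases j) auto
    qed
    finally show ?thesis .
  qed
  then have E_Union: "?E = (\<Union>q. ?F q)" by auto
  have "emeasure M ?E = (\<Sum>q. emeasure M (?F q))"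
    unfolding E_Union by (intro suminf_emeasure[symmetric]) (auto simp: disjoint_family_on_def)
  also have "\<dots> = (\<Sum>q. \<integral>\<^sup>+x. ennreal (g q x) * indicator B x \<partial>lborel)"
    unfolding g_def by (simp add: state_probability[OF B sub])
  also have "\<dots> = (\<integral>\<^sup>+x. (\<Sum>q. ennreal (g q x) * indicator B x) \<partial>lborel)"
    by (intro nn_integral_suminf[symmetric]) measurable
  also have "\<dots> = (\<integral>\<^sup>+x. ennreal (indicator B x *\<^sub>R p x) \<partial>lborel)"
  proof (rule nn_integral_cong)
    fix x :: "real ^ 3"
    show "(\<Sum>q. ennreal (g q x) * indicator B x) = ennreal (indicator B x *\<^sub>R p x)"
    proof (cases "x \<in> B")
      case True
      then have "(\<lambda>q. g q x) sums p x" using sums sub unfolding g_def by auto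
      with True show ?thesis using suminf_ennreal_eq[OF g_nonneg[OF True]] by simp
    qed simp
  qed
  finally have E: "emeasure M ?E = (\<integral>\<^sup>+x. ennreal (indicator B x *\<^sub>R p x) \<partial>lborel)" .
  have nonneg: "0 \<le> indicator B x *\<^sub>R p x" for x using p_nonneg by (auto split: split_indicator)
  have int: "set_integrable lborel B p"
    unfolding set_integrable_def
    by (rule integrableI_nonneg) (use E[symmetric] nonneg in \<open>auto simp: emeasure_eq_measure less_top[symmetric]\<close>)
  have prob_E: "prob ?E = (LINT x:B|lborel. p x)"
    unfolding measure_def E set_lebesgue_integral_def
    by (rule integral_eq_nn_integral[symmetric]) (use nonneg in auto)
  have start: "AE \<omega> in M. position c D 0 \<omega> = 0 \<and> velocity D 0 \<omega> = dir 1"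
    using AE_positive_path
  proof eventually_elim
    case (elim \<omega>)
    then interpret positive_path D \<omega> .
    have "switch_time D 0 \<omega> < switch_time D 1 \<omega>"
      using strict_monoD[OF switch_time_strict_mono, of 0 1] by simp
    then have "num_switches D 0 \<omega> = 0" using num_switches_eqI[of 0 0] by (simp add: switch_time_0)
    then have "velocity D 0 \<omega> = dir 1" by (simp add: velocity_def)
    moreover have "(LINT s:{0..0}|lborel. velocity D s \<omega>) = 0"
      unfolding set_lebesgue_integral_def
      by (rule integral_eq_zero_AE, rule AE_mp[OF AE_lborel_singleton[of 0]], rule AE_I2) (auto split: split_indicator)
    ultimately show ?case by (simp add: position_def)
  qed
  have "\<P>(\<omega> in M. position c D t \<omega> \<in> B \<and> velocity D t \<omega> = dir j
            \<bar> position c D 0 \<omega> = 0 \<and> velocity D 0 \<omega> = dir 1) = prob ?E"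
  proof -
    have "prob {\<omega> \<in> space M. position c D 0 \<omega> = 0 \<and> velocity D 0 \<omega> = dir 1} = 1"
      using start by (subst prob_Collect_eq_1) measurable
    moreover have "prob {\<omega> \<in> space M. (position c D t \<omega> \<in> B \<and> velocity D t \<omega> = dir j) \<and>
        position c D 0 \<omega> = 0 \<and> velocity D 0 \<omega> = dir 1} = prob ?E"
    proof (rule finite_measure_eq_AE)
      show "AE \<omega> in M. \<omega> \<in> {\<omega> \<in> space M. (position c D t \<omega> \<in> B \<and> velocity D t \<omega> = dir j) \<and>
        position c D 0 \<omega> = 0 \<and> velocity D 0 \<omega> = dir 1} \<longleftrightarrow> \<omega> \<in> ?E"
        using start by eventually_elim auto
    qed measurable
    ultimately show ?thesis by (simp add: cond_prob_def)
  qed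
  with int prob_E show "set_integrable lborel B p \<and>
      \<P>(\<omega> in M. position c D t \<omega> \<in> B \<and> velocity D t \<omega> = dir j
              \<bar> position c D 0 \<omega> = 0 \<and> velocity D 0 \<omega> = dir 1)
        = (LINT x:B|lborel. p x)" by simp
qed

end

section \<open>Summation over the cycles\<close>

text \<open>
  With the ratio \<open>l * y / (1 + l * y)\<close> factored out, the dependence on the cycle \<open>q\<close> is a polynomial
  times a geometric term, which prepares the summation over \<open>q\<close>.
\<close>

lemma gcp_density_geometric:
  assumes "l > 0" "y > 0"
  shows "gcp_density l q y = real q * (l * y / (1 + l * y)) ^ q / (y * (1 + l * y))"
    and "gcp_density l (q + 1) y = (real q + 1) * l * (l * y / (1 + l * y)) ^ q / (1 + l * y) ^ 2"
    and "(l * y) ^ q / (1 + l * y) ^ (q + 1) = (l * y / (1 + l * y)) ^ q / (1 + l * y)"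
proof -
  show "gcp_density l q y = real q * (l * y / (1 + l * y)) ^ q / (y * (1 + l * y))"
  proof (cases q)
    case (Suc n)
    then show ?thesis
      using assms by (simp add: gcp_density_def power_divide power_mult_distrib mult_ac)
  qed (simp add: gcp_density_def)
  show "gcp_density l (q + 1) y = (real q + 1) * l * (l * y / (1 + l * y)) ^ q / (1 + l * y) ^ 2"
    using assms by (simp add: gcp_density_def power_divide power_mult_distrib power2_eq_square mult_ac)
  show "(l * y) ^ q / (1 + l * y) ^ (q + 1) = (l * y / (1 + l * y)) ^ q / (1 + l * y)"
    by (simp add: power_divide)
qed

lemma state_density_cycle:
  assumes j: "j \<in> {1..4}"
  shows "state_density l (4 * q + (j - 1)) y =
    (\<Prod>r\<in>{1..4} - {j}. gcp_density (l r) (if r < j then q + 1 else q) (y r)) *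
    ((l j * y j) ^ q / (1 + l j * y j) ^ (q + 1))"
proof -
  have m: "(4 * q + (j - 1)) mod 4 = j - 1" "(4 * q + (j - 1)) div 4 = q"
    using j by (cases j; simp)+
  have j': "j - 1 + 1 = j" using j by simp
  have k: "completed_sojourns (4 * q + (j - 1)) r = (if r < j then q + 1 else q)" for r
    unfolding completed_sojourns_def m using j by auto
  show ?thesis
    unfolding state_density_def m j' Let_def k ..
qed

lemma fD_eq: "fD l y = l 1 * y 1 * (l 2 * y 2) * (l 3 * y 3) * (l 4 * y 4)"
  unfolding fD_def nat_upto_4 by simp

lemma fS_plus_fD:
  "fS l y + fD l y = (1 + l 1 * y 1) * (1 + l 2 * y 2) * (1 + l 3 * y 3) * (1 + l 4 * y 4)"
proof -
  have "{1..<1} = ({} :: nat set)" "{1..<2} = {1 :: nat}" "{1..<3} = {1, 2 :: nat}" "{1..<4} = {1, 2, 3 :: nat}"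
    by auto
  then show ?thesis
    unfolding fS_def fA_def fB_def fC_def fD_eq nat_upto_4
    by (simp add: algebra_simps)
qed

lemma fS_pos:
  assumes "\<And>r. r \<in> {1..4} \<Longrightarrow> l r > 0" "\<And>r. r \<in> {1..4} \<Longrightarrow> y r > 0"
  shows "fS l y > 0"
  unfolding fS_def fA_def fB_def fC_def
  by (intro add_pos_nonneg sum_nonneg mult_nonneg_nonneg zero_less_one)
    (use assms in \<open>auto simp: less_imp_le\<close>)

text \<open>
  With \<open>1 - z = S / N\<close>, the values of the cubic power series at \<open>z = Q / N\<close> become polynomial in \<open>S\<close> and \<open>Q\<close>
  over \<open>S ^ 4\<close>.
\<close>

lemma closed_forms:
  fixes S Q N z :: real
  assumes "S > 0" "Q > 0" and N: "N = S + Q" and z: "z = Q / N"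
  shows "z * (1 + 4 * z + z ^ 2) / (1 - z) ^ 4 = Q * N * ((S ^ 2 + 6 * Q * (S + Q)) / S ^ 4)"
    and "2 * z * (1 + 2 * z) / (1 - z) ^ 4 = 2 * Q * N ^ 2 * ((S + 3 * Q) / S ^ 4)"
    and "2 * z * (2 + z) / (1 - z) ^ 4 = 2 * Q * N ^ 2 * ((2 * S + 3 * Q) / S ^ 4)"
    and "(1 + 4 * z + z ^ 2) / (1 - z) ^ 4 = N ^ 2 * ((S ^ 2 + 6 * Q * (S + Q)) / S ^ 4)"
    and "\<bar>z\<bar> < 1"
proof -
  have pos: "N > 0" using assms by simp
  have 1: "1 - z = S / N" using pos unfolding z by (simp add: field_simps N)
  have p: "1 + 4 * z + z ^ 2 = (S ^ 2 + 6 * Q * (S + Q)) / N ^ 2"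
    using pos unfolding z by (simp add: divide_simps) (simp add: N power2_eq_square algebra_simps)
  have p2: "1 + 2 * z = (S + 3 * Q) / N" "2 + z = (2 * S + 3 * Q) / N"
    using pos unfolding z by (simp_all add: divide_simps) (simp_all add: N algebra_simps)
  show "z * (1 + 4 * z + z ^ 2) / (1 - z) ^ 4 = Q * N * ((S ^ 2 + 6 * Q * (S + Q)) / S ^ 4)"
    and "2 * z * (1 + 2 * z) / (1 - z) ^ 4 = 2 * Q * N ^ 2 * ((S + 3 * Q) / S ^ 4)"
    and "2 * z * (2 + z) / (1 - z) ^ 4 = 2 * Q * N ^ 2 * ((2 * S + 3 * Q) / S ^ 4)"
    and "(1 + 4 * z + z ^ 2) / (1 - z) ^ 4 = N ^ 2 * ((S ^ 2 + 6 * Q * (S + Q)) / S ^ 4)"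
    unfolding 1 p p2 using pos unfolding z
    by (simp_all add: power_divide eval_nat_numeral)
  show "\<bar>z\<bar> < 1" using pos assms unfolding z by simp
qed

text \<open>
  The geometric ratios of the four directions multiply to \<open>z = Q / (S + Q)\<close>, by the expansion of
  \<open>\<Prod>r. 1 + l r * y r\<close> into elementary symmetric functions. Each series is therefore a constant multiple of
  one of the four cubic power series at \<open>z\<close>.
\<close>

lemma state_density_series:
  fixes l y :: "nat \<Rightarrow> real" and d :: real
  defines "S \<equiv> fS l y" and "Q \<equiv> fD l y"
  assumes l: "\<And>r. r \<in> {1..4} \<Longrightarrow> l r > 0" and y: "\<And>r. r \<in> {1..4} \<Longrightarrow> y r > 0"
  shows "(\<lambda>q. state_density l (4 * q + (1 - 1)) y / d) sums
      (l 1 * l 2 * l 3 * l 4 * y 1 * ((S ^ 2 + 6 * Q * (S + Q)) / (d * S ^ 4)))"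
    and "(\<lambda>q. state_density l (4 * q + (2 - 1)) y / d) sums
      (2 * l 1 ^ 2 * l 2 * l 3 * l 4 * y 1 * y 2
           * (1 + l 2 * y 2) * (1 + l 3 * y 3) * (1 + l 4 * y 4) * ((S + 3 * Q) / (d * S ^ 4)))"
    and "(\<lambda>q. state_density l (4 * q + (3 - 1)) y / d) sums
      (2 * l 1 ^ 2 * l 2 ^ 2 * l 3 * l 4 * y 1 * y 2 * y 3
           * (1 + l 3 * y 3) * (1 + l 4 * y 4) * ((2 * S + 3 * Q) / (d * S ^ 4)))"
    and "(\<lambda>q. state_density l (4 * q + (4 - 1)) y / d) sums
      (l 1 * l 2 * l 3 * (1 + l 4 * y 4) * ((S ^ 2 + 6 * Q * (S + Q)) / (d * S ^ 4)))"
proof -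
  define N where "N = S + Q"
  define z where "z = Q / N"
  define a where "a r = 1 + l r * y r" for r
  have lp: "l 1 > 0" "l 2 > 0" "l 3 > 0" "l 4 > 0" and yp: "y 1 > 0" "y 2 > 0" "y 3 > 0" "y 4 > 0"
    using l y by simp_all
  have ap: "a 1 > 0" "a 2 > 0" "a 3 > 0" "a 4 > 0"
    unfolding a_def using lp yp by (simp_all add: add_pos_pos)
  have S: "S > 0" unfolding S_def by (rule fS_pos[OF l y])
  have Q: "Q = l 1 * y 1 * (l 2 * y 2) * (l 3 * y 3) * (l 4 * y 4)" unfolding Q_def by (rule fD_eq)
  then have Q_pos: "Q > 0" using lp yp by simp
  have N: "N = a 1 * a 2 * a 3 * a 4" unfolding N_def S_def Q_def a_def by (rule fS_plus_fD)
  note closed = closed_forms[OF S Q_pos N_def z_def]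
  note sums = cubic_sums[OF closed(5)]
  note g = gcp_density_geometric[of "l r" "y r" for r, folded a_def]
  have A: "{1..4} - {1} = {2, 3, 4::nat}" "{1..4} - {2} = {1, 3, 4::nat}"
    "{1..4} - {3} = {1, 2, 4::nat}" "{1..4} - {4} = {1, 2, 3::nat}" by auto
  \<comment> \<open>abbreviating the powers keeps the field identities below polynomial\<close>
  define W where "W r q = (l r * y r / a r) ^ q" for r q
  have zq: "z ^ q = W 1 q * W 2 q * W 3 q * W 4 q" for q
    unfolding z_def Q N W_def by (simp add: power_divide power_mult_distrib)
  note cycle = state_density_cycle[of _ l _ y, folded a_def]
  have eq1: "state_density l (4 * q + (1 - 1)) y / d = 1 / (d * y 2 * y 3 * y 4 * N) * (real q ^ 3 * z ^ q)" for q
  proof -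
    have "state_density l (4 * q + (1 - 1)) y =
        real q * W 2 q / (y 2 * a 2) * (real q * W 3 q / (y 3 * a 3) * (real q * W 4 q / (y 4 * a 4))) * (W 1 q / a 1)"
      using lp yp by (subst cycle, simp, unfold A) (simp add: g W_def power_divide)
    then show ?thesis by (simp add: zq N power3_eq_cube mult_ac)
  qed
  have eq2: "state_density l (4 * q + (2 - 1)) y / d =
      l 1 / (d * a 1 * y 3 * y 4 * N) * (real q ^ 2 * (real q + 1) * z ^ q)" for q
  proof -
    have "state_density l (4 * q + (2 - 1)) y =
        (real q + 1) * l 1 * W 1 q / a 1 ^ 2 * (real q * W 3 q / (y 3 * a 3) * (real q * W 4 q / (y 4 * a 4))) * (W 2 q / a 2)"
      using lp yp by (subst cycle, simp, unfold A) (simp add: g g(2)[simplified] W_def power_divide power2_eq_square ac_simps)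
    then show ?thesis by (simp add: zq N power2_eq_square mult_ac)
  qed
  have eq3: "state_density l (4 * q + (3 - 1)) y / d =
      l 1 * l 2 / (d * a 1 * a 2 * y 4 * N) * (real q * (real q + 1) ^ 2 * z ^ q)" for q
  proof -
    have "state_density l (4 * q + (3 - 1)) y =
        (real q + 1) * l 1 * W 1 q / a 1 ^ 2 * ((real q + 1) * l 2 * W 2 q / a 2 ^ 2 * (real q * W 4 q / (y 4 * a 4))) * (W 3 q / a 3)"
      using lp yp by (subst cycle, simp, unfold A) (simp add: g g(2)[simplified] W_def power_divide power2_eq_square ac_simps)
    then show ?thesis by (simp add: zq N power2_eq_square mult_ac)
  qed
  have eq4: "state_density l (4 * q + (4 - 1)) y / d =
      l 1 * l 2 * l 3 / (d * a 1 * a 2 * a 3 * N) * ((real q + 1) ^ 3 * z ^ q)" for q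
  proof -
    have "state_density l (4 * q + (4 - 1)) y =
        (real q + 1) * l 1 * W 1 q / a 1 ^ 2 * ((real q + 1) * l 2 * W 2 q / a 2 ^ 2 * ((real q + 1) * l 3 * W 3 q / a 3 ^ 2)) * (W 4 q / a 4)"
      using lp yp by (subst cycle, simp, unfold A) (simp add: g g(2)[simplified] W_def power_divide power2_eq_square ac_simps)
    then show ?thesis by (simp add: zq N power2_eq_square power3_eq_cube mult_ac)
  qed
  show "(\<lambda>q. state_density l (4 * q + (1 - 1)) y / d) sums
      (l 1 * l 2 * l 3 * l 4 * y 1 * ((S ^ 2 + 6 * Q * (S + Q)) / (d * S ^ 4)))"
  proof -
    have coeff: "1 / (y 2 * y 3 * y 4 * N) * (Q * N) = l 1 * l 2 * l 3 * l 4 * y 1"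
      unfolding Q N a_def[symmetric] using lp yp ap by (simp add: divide_simps power2_eq_square)
    have "1 / (d * y 2 * y 3 * y 4 * N) * (Q * N * ((S ^ 2 + 6 * Q * (S + Q)) / S ^ 4)) =
        1 / (y 2 * y 3 * y 4 * N) * (Q * N) * ((S ^ 2 + 6 * Q * (S + Q)) / (d * S ^ 4))"
      by (simp add: mult_ac)
    with sums_mult[OF sums(1), unfolded closed, of "1 / (d * y 2 * y 3 * y 4 * N)"] show ?thesis
      unfolding eq1 coeff by (simp only:)
  qed
  show "(\<lambda>q. state_density l (4 * q + (2 - 1)) y / d) sums
      (2 * l 1 ^ 2 * l 2 * l 3 * l 4 * y 1 * y 2
           * (1 + l 2 * y 2) * (1 + l 3 * y 3) * (1 + l 4 * y 4) * ((S + 3 * Q) / (d * S ^ 4)))"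
  proof -
    have coeff: "l 1 / (a 1 * y 3 * y 4 * N) * (2 * Q * N ^ 2) = 2 * l 1 ^ 2 * l 2 * l 3 * l 4 * y 1 * y 2
           * (1 + l 2 * y 2) * (1 + l 3 * y 3) * (1 + l 4 * y 4)"
      unfolding Q N a_def[symmetric] using lp yp ap by (simp add: divide_simps power2_eq_square)
    have "l 1 / (d * a 1 * y 3 * y 4 * N) * (2 * Q * N ^ 2 * ((S + 3 * Q) / S ^ 4)) =
        l 1 / (a 1 * y 3 * y 4 * N) * (2 * Q * N ^ 2) * ((S + 3 * Q) / (d * S ^ 4))"
      by (simp add: mult_ac)
    with sums_mult[OF sums(2), unfolded closed, of "l 1 / (d * a 1 * y 3 * y 4 * N)"] show ?thesis
      unfolding eq2 coeff by (simp only:)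
  qed
  show "(\<lambda>q. state_density l (4 * q + (3 - 1)) y / d) sums
      (2 * l 1 ^ 2 * l 2 ^ 2 * l 3 * l 4 * y 1 * y 2 * y 3
           * (1 + l 3 * y 3) * (1 + l 4 * y 4) * ((2 * S + 3 * Q) / (d * S ^ 4)))"
  proof -
    have coeff: "l 1 * l 2 / (a 1 * a 2 * y 4 * N) * (2 * Q * N ^ 2) = 2 * l 1 ^ 2 * l 2 ^ 2 * l 3 * l 4 * y 1 * y 2 * y 3
           * (1 + l 3 * y 3) * (1 + l 4 * y 4)"
      unfolding Q N a_def[symmetric] using lp yp ap by (simp add: divide_simps power2_eq_square)
    have "l 1 * l 2 / (d * a 1 * a 2 * y 4 * N) * (2 * Q * N ^ 2 * ((2 * S + 3 * Q) / S ^ 4)) =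
        l 1 * l 2 / (a 1 * a 2 * y 4 * N) * (2 * Q * N ^ 2) * ((2 * S + 3 * Q) / (d * S ^ 4))"
      by (simp add: mult_ac)
    with sums_mult[OF sums(3), unfolded closed, of "l 1 * l 2 / (d * a 1 * a 2 * y 4 * N)"] show ?thesis
      unfolding eq3 coeff by (simp only:)
  qed
  show "(\<lambda>q. state_density l (4 * q + (4 - 1)) y / d) sums
      (l 1 * l 2 * l 3 * (1 + l 4 * y 4) * ((S ^ 2 + 6 * Q * (S + Q)) / (d * S ^ 4)))"
  proof -
    have coeff: "l 1 * l 2 * l 3 / (a 1 * a 2 * a 3 * N) * (N ^ 2) = l 1 * l 2 * l 3 * (1 + l 4 * y 4)"
      unfolding Q N a_def[symmetric] using lp yp ap by (simp add: divide_simps power2_eq_square)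
    have "l 1 * l 2 * l 3 / (d * a 1 * a 2 * a 3 * N) * (N ^ 2 * ((S ^ 2 + 6 * Q * (S + Q)) / S ^ 4)) =
        l 1 * l 2 * l 3 / (a 1 * a 2 * a 3 * N) * (N ^ 2) * ((S ^ 2 + 6 * Q * (S + Q)) / (d * S ^ 4))"
      by (simp add: mult_ac)
    with sums_mult[OF sums(4), unfolded closed, of "l 1 * l 2 * l 3 / (d * a 1 * a 2 * a 3 * N)"] show ?thesis
      unfolding eq4 coeff by (simp only:)
  qed
qed

(* In the density for direction 3 the last factor is 2 * S + 3 * Q, where the source prints
   S + 3 * Q. The density is a sum over n of n * (n + 1)^2 * z^n, with z = Q / (S + Q), which is
   2 * z * (2 + z) / (1 - z)^4; for direction 2 it is a sum of n^2 * (n + 1) * z^n, which is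
   2 * z * (1 + 2 * z) / (1 - z)^4 and does give S + 3 * Q. *)
theorem theorem5:
  fixes M :: "'w measure"
    and lam :: "nat \<Rightarrow> real"
    and al :: "nat \<Rightarrow> 'w \<Rightarrow> real"
    and D :: "nat \<Rightarrow> nat \<Rightarrow> 'w \<Rightarrow> real"
    and c t :: real
  assumes "prob_space M"
    and "c > 0" and "t > 0"
    and "\<And>j. j \<in> {1..4} \<Longrightarrow> lam j > 0"
    and "\<And>j. j \<in> {1..4} \<Longrightarrow> gcp_interarrivals M (lam j) (al j) (D j)"
    and "prob_space.indep_vars M (\<lambda>_. PiM {1..} (\<lambda>_. borel))
           (\<lambda>j \<omega>. \<lambda>k\<in>{1..}. D j k \<omega>) {1..4}"
  shows "det (dir_matrix c) = 16 * sqrt 3 / 9 * c ^ 3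
    \<and> is_motion_density M c D t 1 (\<lambda>x.
           let \<tau> = tau c t x; S = fS lam \<tau>; Q = fD lam \<tau> in
           lam 1 * lam 2 * lam 3 * lam 4 * \<tau> 1
           * ((S ^ 2 + 6 * Q * (S + Q)) / (det (dir_matrix c) * S ^ 4)))
    \<and> is_motion_density M c D t 2 (\<lambda>x.
           let \<tau> = tau c t x; S = fS lam \<tau>; Q = fD lam \<tau> in
           2 * lam 1 ^ 2 * lam 2 * lam 3 * lam 4 * \<tau> 1 * \<tau> 2
           * (1 + lam 2 * \<tau> 2) * (1 + lam 3 * \<tau> 3) * (1 + lam 4 * \<tau> 4)
           * ((S + 3 * Q) / (det (dir_matrix c) * S ^ 4)))
    \<and> is_motion_density M c D t 3 (\<lambda>x.
           let \<tau> = tau c t x; S = fS lam \<tau>; Q = fD lam \<tau> in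
           2 * lam 1 ^ 2 * lam 2 ^ 2 * lam 3 * lam 4 * \<tau> 1 * \<tau> 2 * \<tau> 3
           * (1 + lam 3 * \<tau> 3) * (1 + lam 4 * \<tau> 4)
           * ((2 * S + 3 * Q) / (det (dir_matrix c) * S ^ 4)))
    \<and> is_motion_density M c D t 4 (\<lambda>x.
           let \<tau> = tau c t x; S = fS lam \<tau>; Q = fD lam \<tau> in
           lam 1 * lam 2 * lam 3 * (1 + lam 4 * \<tau> 4)
           * ((S ^ 2 + 6 * Q * (S + Q)) / (det (dir_matrix c) * S ^ 4)))"
proof -
  interpret cyclic_motion M lam al D c t
    using assms by (intro cyclic_motion.intro cyclic_motion_axioms.intro) auto
  have [measurable (raw)]:
    "(\<lambda>x. fS lam (tau c t x)) \<in> borel_measurable borel" "(\<lambda>x. fD lam (tau c t x)) \<in> borel_measurable borel"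
    unfolding fS_def fA_def fB_def fC_def fD_def by measurable
  note density = state_density_series_is_motion_density
  note series = state_density_series[OF lam_pos tau_pos[OF c_pos]]
  show ?thesis
    unfolding Let_def
    by (intro conjI det_dir_matrix density series; ((simp; fail) | measurable))
qed

end
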